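(* For $k\ge1$ consider the permutations $$w_k^-=(2,4,\dots,2k,2k-1,2k-3,\dots,3,1)\in\mathbb{S}_{2k},\qquad w_k^+=(2,4,\dots,2k,2k+1,2k-1,\dots,3,1)\in\mathbb{S}_{2k+1}$$ (in one-line notation). Then $$\mathfrak{S}_{w_k^-}(1)=\mathrm{CSTCPP}(k),\qquad\mathfrak{S}_{w_k^+}(1)=\mathrm{VSASM}(k),$$ where $\mathfrak{S}_w(1)$ denotes the value of the Schubert polynomial $\mathfrak{S}_w$ at $x_1=x_2=\cdots=1$.
   Context: $\mathrm{VSASM}(n)$ is the number of alternating sign $(2n+1)\times(2n+1)$ matrices symmetric about the vertical axis, $$\mathrm{VSASM}(n)=\prod_{j=1}^{n-1}\frac{(3j+2)(6j+3)!\,(2j+1)!}{(4j+2)!\,(4j+3)!},$$ and $\mathrm{CSTCPP}(n)$ is the number of cyclically symmetric transpose complement plane partitions, given by $$\mathrm{CSTCPP}(n)=\prod_{j=1}^{n-1}\frac{(3j+1)(6j)!\,(2j)!}{(4j+1)!\,(4j)!}.$$ Schubert polynomials are the standard ones of Lascoux–Schützenberger ($\mathfrak{S}_{w_0}=x_1^{n-1}x_2^{n-2}\cdots x_{n-1}$ for the longest $w_0\in\mathbb{S}_n$, and $\mathfrak{S}_{ws_i}=\partial_i\mathfrak{S}_w$ if $\ell(ws_i)=\ell(w)-1$). *)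

theory Defs
  imports "HOL-Library.Poly_Mapping" "HOL-Combinatorics.Combinatorics"
begin

text \<open>
  Polynomials with integer coefficients in the variables \<open>x\<^sub>1, x\<^sub>2, \<dots>\<close>: a monomial is the finitely
  supported function giving the exponent of each variable. Only the indices \<open>\<ge> 1\<close> are used.
\<close>

type_synonym monom = "nat \<Rightarrow>\<^sub>0 nat"
type_synonym mpoly = "monom \<Rightarrow>\<^sub>0 int"

definition var :: "nat \<Rightarrow> mpoly" where
  "var i = Poly_Mapping.single (Poly_Mapping.single i 1) 1"

definition eval_mpoly :: "(nat \<Rightarrow> int) \<Rightarrow> mpoly \<Rightarrow> int" where
  "eval_mpoly a f = (\<Sum>m \<in> Poly_Mapping.keys f.
     Poly_Mapping.lookup f m * (\<Prod>i \<in> Poly_Mapping.keys m. a i ^ Poly_Mapping.lookup m i))"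

abbreviation adj_transp :: "nat \<Rightarrow> nat \<Rightarrow> nat" where
  "adj_transp i \<equiv> transpose i (Suc i)"

text \<open>
  Exchanging \<open>x\<^sub>i\<close> and \<open>x\<^sub>i\<^sub>+\<^sub>1\<close>: the coefficient of \<open>swap_vars i f\<close> at \<open>m\<close> is that of \<open>f\<close> at
  \<open>m \<circ> s\<^sub>i\<close> (\<open>map_key\<close> is precomposition with an injective function).
\<close>

definition swap_vars :: "nat \<Rightarrow> mpoly \<Rightarrow> mpoly" where
  "swap_vars i f = Poly_Mapping.map_key (Poly_Mapping.map_key (adj_transp i)) f"

text \<open>
  The divided difference \<open>\<partial>\<^sub>i f = (f - s\<^sub>i f) / (x\<^sub>i - x\<^sub>i\<^sub>+\<^sub>1)\<close>, as an exact quotient of polynomials.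
\<close>

definition divided_diff :: "nat \<Rightarrow> mpoly \<Rightarrow> mpoly" where
  "divided_diff i f = (THE g. (var i - var (Suc i)) * g = f - swap_vars i f)"

text \<open>
  Permutations in \<open>S\<^sub>n\<close> are functions on the naturals permuting \<open>{1..n}\<close> and fixing everything else;
  \<open>one_line [w\<^sub>1, \<dots>, w\<^sub>n]\<close> is the permutation \<open>i \<mapsto> w\<^sub>i\<close>.
\<close>

definition one_line :: "nat list \<Rightarrow> nat \<Rightarrow> nat" where
  "one_line ws i = (if 1 \<le> i \<and> i \<le> length ws then ws ! (i - 1) else i)"

definition perm_length :: "(nat \<Rightarrow> nat) \<Rightarrow> nat" where
  "perm_length w = card {(i, j). i < j \<and> w j < w i}"

definition longest_perm :: "nat \<Rightarrow> nat \<Rightarrow> nat" where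
  "longest_perm n = one_line (rev [1..<Suc n])"

text \<open>
  \<open>schubert_rel n w f\<close>: the polynomial \<open>f\<close> is obtained for \<open>w \<in> S\<^sub>n\<close> by descending from the longest
  permutation along some sequence of adjacent transpositions, which act on positions. The result
  does not depend on the sequence, because the divided differences satisfy the braid relations.
\<close>

inductive schubert_rel :: "nat \<Rightarrow> (nat \<Rightarrow> nat) \<Rightarrow> mpoly \<Rightarrow> bool" for n :: nat where
  longest: "schubert_rel n (longest_perm n) (\<Prod>i = 1..<n. var i ^ (n - i))"
| step: "schubert_rel n w f \<Longrightarrow> 1 \<le> i \<Longrightarrow> i < n \<Longrightarrow>
    perm_length w = Suc (perm_length (w \<circ> adj_transp i)) \<Longrightarrow>
    schubert_rel n (w \<circ> adj_transp i) (divided_diff i f)"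

definition schubert :: "nat \<Rightarrow> (nat \<Rightarrow> nat) \<Rightarrow> mpoly" where
  "schubert n w = (THE f. schubert_rel n w f)"

definition w_minus :: "nat \<Rightarrow> nat \<Rightarrow> nat" where
  "w_minus k = one_line (map (\<lambda>i. 2 * i) [1..<Suc k] @ rev (map (\<lambda>i. 2 * i - 1) [1..<Suc k]))"

definition w_plus :: "nat \<Rightarrow> nat \<Rightarrow> nat" where
  "w_plus k = one_line (map (\<lambda>i. 2 * i) [1..<Suc k] @ rev (map (\<lambda>i. 2 * i - 1) [1..<Suc (Suc k)]))"

text \<open>
  The two counting sequences are given by their product formulas. The products are taken in the
  rationals, since the individual factors are not integers in general.
\<close>

definition VSASM :: "nat \<Rightarrow> rat" where
  "VSASM n = (\<Prod>j = 1..<n.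
     (3 * of_nat j + 2) * fact (6 * j + 3) * fact (2 * j + 1) / (fact (4 * j + 2) * fact (4 * j + 3)))"

definition CSTCPP :: "nat \<Rightarrow> rat" where
  "CSTCPP n = (\<Prod>j = 1..<n.
     (3 * of_nat j + 1) * fact (6 * j) * fact (2 * j) / (fact (4 * j + 1) * fact (4 * j)))"

end

theory Submission
  imports
    Defs
    "Jordan_Normal_Form.Determinant"
    "HOL-Computational_Algebra.Formal_Power_Series"
begin

text \<open>
  The permutations \<open>w\<^sub>k\<^sup>-\<close> and \<open>w\<^sub>k\<^sup>+\<close> are the cases \<open>m = 2k\<close> and \<open>m = 2k + 1\<close> of one family: the even
  numbers up to \<open>m\<close> in increasing order, then the odd ones in decreasing order. The arrangement for
  \<open>m + 1\<close> is the one for \<open>m\<close> with the new maximum inserted right after the even numbers, so it is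
  reached from the longest permutation by moving the values \<open>2, 3, \<dots>\<close> in turn to the right past the
  smaller even numbers.

  This chain of descents fits a determinant. The staircase monomial of the longest permutation is
  a determinant of complete homogeneous polynomials whose rows use the variable sets
  \<open>{x\<^sub>1}, {x\<^sub>1, x\<^sub>2}, {x\<^sub>1, x\<^sub>2, x\<^sub>3}, \<dots>\<close> (\<open>det_hsym_staircase\<close>), and \<open>\<partial>\<^sub>p\<close> adds the variable
  \<open>x\<^sub>p\<^sub>+\<^sub>1\<close> to the row on \<open>x\<^sub>1, \<dots>, x\<^sub>p\<close> as long as only one row uses exactly these variables
  (\<open>divided_diff_hsym_det\<close>). Along the chain this is always so, and the Schubert polynomial comes out as
  a determinant of the same kind (\<open>schubert_zigzag\<close>). That any single chain determines the Schubert
  polynomial is a consequence of the braid relations (\<open>schubert_rel_unique\<close>).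

  At \<open>x = 1\<close>, with \<open>N = m - 1\<close>, the entry in row \<open>a\<close> and column \<open>b\<close> is the binomial coefficient
  of \<open>N - a + b\<close> over \<open>\<lfloor>(N + a) / 2\<rfloor>\<close>. Two applications of Vandermonde's convolution multiply this
  matrix by unitriangular ones so that its rows become, up to signs and alternately, shifted copies
  of the sequences of binomial coefficients \<open>3k\<close> over \<open>k\<close> and \<open>3k + 1\<close> over \<open>k\<close>
  (\<open>det_binomial_to_gauss_rows\<close>). These are the coefficients of the hypergeometric series \<open>G\<^sub>0\<close> and
  \<open>G\<^sub>1\<close> that start one of Gauss's continued fractions: there are series \<open>G\<^sub>i\<close> with constant term
  \<open>1\<close> and explicit rational numbers \<open>\<lambda>\<^sub>i\<close> such that \<open>G\<^sub>i - G\<^sub>i\<^sub>+\<^sub>1 = \<lambda>\<^sub>i t G\<^sub>i\<^sub>+\<^sub>2\<close>. Used as row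
  operations, these relations make the matrix triangular, and its determinant is a product of
  \<open>\<lambda>\<^sub>i\<close> (\<open>det_gauss_rows\<close>). Enlarging \<open>m\<close> by two multiplies the determinant by
  \<open>\<lambda>\<^sub>0 \<lambda>\<^sub>1 \<dots> \<lambda>\<^sub>m\<^sub>-\<^sub>1\<close>, which is exactly the next factor of the product formula.
\<close>

section \<open>Polynomials and divided differences\<close>

lemma mpoly_induct [case_names single add]:
  fixes f :: mpoly
  assumes single: "\<And>m c. P (Poly_Mapping.single m c)"
    and add: "\<And>f g. P f \<Longrightarrow> P g \<Longrightarrow> P (f + g)"
  shows "P f"
proof (induction f rule: Poly_Mapping.update_induct)
  case const
  then show ?case using single[of 0 0] by simp
next
  case (update f m c)
  have "Poly_Mapping.update m c f = f + Poly_Mapping.single m c"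
    using update.hyps(1)
    by (intro poly_mapping_eqI)
      (auto simp: lookup_update lookup_add lookup_single in_keys_iff when_def)
  with update.IH single add show ?case by simp
qed

abbreviation swap_monom :: "nat \<Rightarrow> monom \<Rightarrow> monom" where
  "swap_monom i \<equiv> Poly_Mapping.map_key (adj_transp i)"

lemma swap_monom_involutive [simp]: "swap_monom i (swap_monom i m) = m"
  by (simp add: map_key_compose map_key_id o_def)

lemma inj_swap_monom: "inj (swap_monom i)"
  by (metis injI swap_monom_involutive)

lemma swap_monom_add: "swap_monom i (m + m') = swap_monom i m + swap_monom i m'"
  by (simp add: map_key_plus)

lemma swap_vars_single [simp]:
  "swap_vars i (Poly_Mapping.single m c) = Poly_Mapping.single (swap_monom i m) c"
  unfolding swap_vars_def
  using map_key_single[OF inj_swap_monom, of i "swap_monom i m" c] by simp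

lemma swap_vars_add: "swap_vars i (f + g) = swap_vars i f + swap_vars i g"
  unfolding swap_vars_def by (simp add: map_key_plus inj_swap_monom)

lemma swap_vars_mult: "swap_vars i (f * g) = swap_vars i f * swap_vars i g"
proof (induction f rule: mpoly_induct)
  case (single m c)
  show ?case
    by (induction g rule: mpoly_induct)
      (simp_all add: mult_single swap_monom_add swap_vars_add distrib_left)
next
  case (add f f')
  then show ?case by (simp add: distrib_right swap_vars_add)
qed

lemma swap_vars_0: "swap_vars i 0 = 0"
  using swap_vars_single[of i 0 0] by simp

lemma swap_vars_1: "swap_vars i 1 = 1"
  using swap_vars_single[of i 0 1] by simp

interpretation swap_vars: comm_ring_hom "swap_vars i"
  by unfold_locales (simp_all add: swap_vars_0 swap_vars_1 swap_vars_add swap_vars_mult)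

lemma swap_vars_var [simp]: "swap_vars i (var j) = var (adj_transp i j)"
proof -
  have "swap_monom i (Poly_Mapping.single j 1) = Poly_Mapping.single (adj_transp i j) 1"
    using map_key_single[of "adj_transp i" "adj_transp i j" "1::nat"] by simp
  then show ?thesis by (simp add: var_def)
qed

lemma var_diff_nonzero: "i \<noteq> j \<Longrightarrow> var i - var j \<noteq> 0"
proof
  assume "i \<noteq> j" "var i - var j = 0"
  then have "Poly_Mapping.lookup (var i) (Poly_Mapping.single i 1)
      = Poly_Mapping.lookup (var j) (Poly_Mapping.single i 1)" by simp
  moreover have "Poly_Mapping.single j (1::nat) \<noteq> Poly_Mapping.single i 1"
    using \<open>i \<noteq> j\<close> by (metis lookup_single_eq lookup_single_not_eq one_neq_zero)
  ultimately show False by (simp add: var_def lookup_single_not_eq)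
qed

lemma divided_diff_eqI:
  assumes "(var i - var (Suc i)) * g = f - swap_vars i f"
  shows "divided_diff i f = g"
  unfolding divided_diff_def
proof (rule the_equality)
  show "(var i - var (Suc i)) * g = f - swap_vars i f" by (fact assms)
next
  fix g'
  assume "(var i - var (Suc i)) * g' = f - swap_vars i f"
  with assms have "(var i - var (Suc i)) * g' = (var i - var (Suc i)) * g" by simp
  with var_diff_nonzero[of i "Suc i"] show "g' = g" by simp
qed

text \<open>
  The twisted Leibniz rule
  \<open>f g - s(f g) = (f - s f) g + s f (g - s g)\<close> reduces divisibility for all polynomials to
  divisibility for the variables.
\<close>

lemma var_dvd_diff_swap_mult:
  assumes "d dvd f - swap_vars i f" "d dvd g - swap_vars i g"
  shows "d dvd f * g - swap_vars i (f * g)"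
proof -
  have "f * g - swap_vars i (f * g)
      = (f - swap_vars i f) * g + swap_vars i f * (g - swap_vars i g)"
    by (simp add: swap_vars_mult algebra_simps)
  with assms show ?thesis by simp
qed

lemma var_power: "var j ^ e = Poly_Mapping.single (Poly_Mapping.single j e) 1"
proof (induction e)
  case (Suc e)
  then show ?case
    by (simp add: var_def mult_single flip: single_add)
qed simp

lemma var_diff_dvd_diff_swap: "var i - var (Suc i) dvd f - swap_vars i f"
proof (induction f rule: mpoly_induct)
  case (single m c)
  have const: "var i - var (Suc i) dvd Poly_Mapping.single 0 c - swap_vars i (Poly_Mapping.single 0 c)"
    for c by simp
  have var: "var i - var (Suc i) dvd var j - swap_vars i (var j)" for j
  proof -
    consider "j = i" | "j = Suc i" | "j \<noteq> i" "j \<noteq> Suc i" by blast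
    then show ?thesis
    proof cases
      case 2
      have "var (Suc i) - var i = (var i - var (Suc i)) * - 1" by simp
      with 2 show ?thesis by (metis dvd_triv_left swap_vars_var transpose_apply_second)
    qed (simp_all add: transpose_eq_iff)
  qed
  have power: "var i - var (Suc i) dvd var j ^ e - swap_vars i (var j ^ e)" for j e
  proof (induction e)
    case 0
    show ?case by (simp add: swap_vars_1)
  next
    case (Suc e)
    show ?case unfolding power_Suc by (rule var_dvd_diff_swap_mult[OF var Suc])
  qed
  have monom: "var i - var (Suc i) dvd Poly_Mapping.single m 1 - swap_vars i (Poly_Mapping.single m 1)"
  proof (induction m rule: Poly_Mapping.update_induct)
    case const
    then show ?case by simp
  next
    case (update m j e)
    have "Poly_Mapping.update j e m = m + Poly_Mapping.single j e"
      using update.hyps(1)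
      by (intro poly_mapping_eqI)
        (auto simp: lookup_update lookup_add lookup_single in_keys_iff when_def)
    then have "Poly_Mapping.single (Poly_Mapping.update j e m) 1
        = Poly_Mapping.single m (1::int) * var j ^ e"
      by (simp add: var_power mult_single)
    with var_dvd_diff_swap_mult[OF update.IH power] show ?case by metis
  qed
  have "Poly_Mapping.single m c = Poly_Mapping.single 0 c * Poly_Mapping.single m (1::int)"
    by (simp add: mult_single)
  with var_dvd_diff_swap_mult[OF const monom] show ?case by metis
next
  case (add f g)
  have "f + g - swap_vars i (f + g) = (f - swap_vars i f) + (g - swap_vars i g)"
    by (simp add: swap_vars_add)
  with add show ?case by (metis dvd_add)
qed

lemma divided_diff_mult:
  "(var i - var (Suc i)) * divided_diff i f = f - swap_vars i f"
proof -
  obtain g where "(var i - var (Suc i)) * g = f - swap_vars i f"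
    using var_diff_dvd_diff_swap[of i f] by (metis dvd_def)
  with divided_diff_eqI[OF this] show ?thesis by simp
qed

text \<open>
  The braid and commutation relations for divided differences come from those for the
  exchanges of variables after clearing the denominators \<open>x\<^sub>i - x\<^sub>i\<^sub>+\<^sub>1\<close>.
\<close>

lemma swap_vars_braid:
  "swap_vars i (swap_vars (Suc i) (swap_vars i f))
    = swap_vars (Suc i) (swap_vars i (swap_vars (Suc i) f))"
proof (induction f rule: mpoly_induct)
  case (single m c)
  have "adj_transp i \<circ> adj_transp (Suc i) \<circ> adj_transp i
      = adj_transp (Suc i) \<circ> adj_transp i \<circ> adj_transp (Suc i)"
    by (auto simp: fun_eq_iff transpose_def)
  then show ?case by (simp add: map_key_compose inj_compose comp_assoc)
qed (simp add: swap_vars_add)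

lemma swap_vars_commute:
  assumes "Suc i < j"
  shows "swap_vars i (swap_vars j f) = swap_vars j (swap_vars i f)"
proof (induction f rule: mpoly_induct)
  case (single m c)
  have "adj_transp i \<circ> adj_transp j = adj_transp j \<circ> adj_transp i"
    using assms by (auto simp: fun_eq_iff transpose_def)
  then show ?case by (simp add: map_key_compose inj_compose)
qed (simp add: swap_vars_add)

lemma swap_vars_swap_vars [simp]: "swap_vars i (swap_vars i f) = f"
  by (induction f rule: mpoly_induct) (simp_all add: swap_vars_add)

lemma swap_divided_diff:
  "swap_vars j (var i - var (Suc i)) * swap_vars j (divided_diff i f)
    = swap_vars j f - swap_vars j (swap_vars i f)"
  by (metis divided_diff_mult swap_vars_mult swap_vars.hom_minus)

lemma divided_diff_commute:
  assumes "Suc i < j"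
  shows "divided_diff i (divided_diff j f) = divided_diff j (divided_diff i f)"
proof -
  define a where "a = var i - var (Suc i)"
  define b where "b = var j - var (Suc j)"
  have sa: "swap_vars j a = a" and sb: "swap_vars i b = b"
    using assms by (simp_all add: a_def b_def swap_vars.hom_minus transpose_def)
  have *: "a * (b * divided_diff i (divided_diff j f)) = f - swap_vars j f - swap_vars i f + swap_vars i (swap_vars j f)"
  proof -
    have "a * (b * divided_diff i (divided_diff j f)) = b * (a * divided_diff i (divided_diff j f))"
      by (simp add: ac_simps)
    also have "a * divided_diff i (divided_diff j f)
        = divided_diff j f - swap_vars i (divided_diff j f)"
      unfolding a_def by (rule divided_diff_mult)
    also have "b * (divided_diff j f - swap_vars i (divided_diff j f))
       = b * divided_diff j f - swap_vars i b * swap_vars i (divided_diff j f)"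
      by (simp add: sb algebra_simps)
    also have "\<dots> = f - swap_vars j f - (swap_vars i f - swap_vars i (swap_vars j f))"
      unfolding b_def swap_divided_diff by (simp add: divided_diff_mult)
    finally show ?thesis by (simp add: algebra_simps)
  qed
  have **: "a * (b * divided_diff j (divided_diff i f)) = f - swap_vars j f - swap_vars i f + swap_vars i (swap_vars j f)"
  proof -
    have "b * divided_diff j (divided_diff i f)
        = divided_diff i f - swap_vars j (divided_diff i f)"
      unfolding b_def by (rule divided_diff_mult)
    then have "a * (b * divided_diff j (divided_diff i f)) 
       = a * divided_diff i f - swap_vars j a * swap_vars j (divided_diff i f)"
      by (simp only: sa right_diff_distrib)
    also have "\<dots> = f - swap_vars i f - (swap_vars j f - swap_vars j (swap_vars i f))"
      unfolding a_def swap_divided_diff by (simp add: divided_diff_mult)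
    finally show ?thesis by (simp add: algebra_simps swap_vars_commute[OF assms])
  qed
  have "a \<noteq> 0" "b \<noteq> 0"
    unfolding a_def b_def by (simp_all add: var_diff_nonzero del: right_minus_eq)
  with * ** show ?thesis by (metis mult_left_cancel)
qed

text \<open>
  With \<open>a\<close>, \<open>b\<close>, \<open>c\<close> the three differences of the variables involved, both sides multiplied by
  \<open>a b c\<close> are the antisymmetrization of \<open>f\<close> over the six permutations of these variables.
\<close>

lemma divided_diff_braid:
  "divided_diff i (divided_diff (Suc i) (divided_diff i f))
    = divided_diff (Suc i) (divided_diff i (divided_diff (Suc i) f))"
proof -
  define a where "a = var i - var (Suc i)"
  define b where "b = var (Suc i) - var (Suc (Suc i))"
  define c where "c = var i - var (Suc (Suc i))"
  let ?s = "swap_vars i" and ?t = "swap_vars (Suc i)"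
  have act: "?s a = - a" "?s b = c" "?s c = b" "?t a = c" "?t b = - b" "?t c = a"
    by (simp_all add: a_def b_def c_def swap_vars.hom_minus transpose_def)
  have ne: "a \<noteq> 0" "b \<noteq> 0" "c \<noteq> 0"
    unfolding a_def b_def c_def by (simp_all add: var_diff_nonzero del: right_minus_eq)
  have ab: "a + b = c" by (simp add: a_def b_def c_def)
  have da: "a * divided_diff i g = g - ?s g" for g
    unfolding a_def by (rule divided_diff_mult)
  have db: "b * divided_diff (Suc i) g = g - ?t g" for g
    unfolding b_def by (rule divided_diff_mult)
  have scaled_st: "a * b * c * divided_diff i (divided_diff (Suc i) g) 
      = c * (g - ?t g) - b * (?s g - ?s (?t g))" for g
  proof -
    have "c * ?s (divided_diff (Suc i) g) = ?s g - ?s (?t g)"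
      using arg_cong[OF db, of ?s g] by (simp add: swap_vars_mult swap_vars.hom_minus act)
    moreover have "a * b * c * divided_diff i (divided_diff (Suc i) g) 
        = b * c * (divided_diff (Suc i) g - ?s (divided_diff (Suc i) g))"
      unfolding da[symmetric] by (simp add: ac_simps)
    moreover have "\<dots> = c * (b * divided_diff (Suc i) g) - b * (c * ?s (divided_diff (Suc i) g))"
      by (simp add: algebra_simps)
    ultimately show ?thesis by (simp only: db)
  qed
  have scaled_ts: "a * b * c * divided_diff (Suc i) (divided_diff i g) 
      = c * (g - ?s g) - a * (?t g - ?t (?s g))" for g
  proof -
    have "c * ?t (divided_diff i g) = ?t g - ?t (?s g)"
      using arg_cong[OF da, of ?t g] by (simp add: swap_vars_mult swap_vars.hom_minus act)
    moreover have "a * b * c * divided_diff (Suc i) (divided_diff i g) 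
        = a * c * (divided_diff i g - ?t (divided_diff i g))"
      unfolding db[symmetric] by (simp add: ac_simps)
    moreover have "\<dots> = c * (a * divided_diff i g) - a * (c * ?t (divided_diff i g))"
      by (simp add: algebra_simps)
    ultimately show ?thesis by (simp only: da)
  qed
  let ?A = "f - ?s f - ?t f + ?s (?t f) + ?t (?s f) - ?s (?t (?s f))"
  have L: "a * b * c * divided_diff i (divided_diff (Suc i) (divided_diff i f)) = ?A"
  proof -
    let ?g = "divided_diff i f"
    \<comment> \<open>A divided difference is symmetric in the two variables it involves.\<close>
    have 1: "?s ?g = ?g"
    proof -
      have "- a * ?s ?g = ?s f - f"
        using arg_cong[OF da, of ?s f] by (simp add: swap_vars_mult swap_vars.hom_minus act)
      then have "a * ?s ?g = a * ?g"
        unfolding da by (metis minus_diff_eq minus_mult_left minus_minus)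
      then show ?thesis using ne mult_left_cancel by blast
    qed
    have 2: "c * ?t ?g = ?t f - ?t (?s f)"
      using arg_cong[OF da, of ?t f] by (simp add: swap_vars_mult swap_vars.hom_minus act)
    have 3: "b * ?s (?t ?g) = ?s (?t f) - ?s (?t (?s f))"
      using arg_cong[OF 2, of ?s] by (simp add: swap_vars_mult swap_vars.hom_minus act)
    have "a * b * c * divided_diff i (divided_diff (Suc i) ?g)
        = c * ?g - b * ?g - c * ?t ?g + b * ?s (?t ?g)"
      unfolding scaled_st 1 by (simp add: algebra_simps)
    also have "\<dots> = a * ?g - c * ?t ?g + b * ?s (?t ?g)"
      unfolding ab[symmetric] by (simp add: algebra_simps)
    finally show ?thesis unfolding 2 3 da by simp
  qed
  have R: "a * b * c * divided_diff (Suc i) (divided_diff i (divided_diff (Suc i) f))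
      = f - ?s f - ?t f + ?s (?t f) + ?t (?s f) - ?t (?s (?t f))"
  proof -
    let ?g = "divided_diff (Suc i) f"
    have 1: "?t ?g = ?g"
    proof -
      have "- b * ?t ?g = ?t f - f"
        using arg_cong[OF db, of ?t f] by (simp add: swap_vars_mult swap_vars.hom_minus act)
      then have "b * ?t ?g = b * ?g"
        unfolding db by (metis minus_diff_eq minus_mult_left minus_minus)
      then show ?thesis using ne mult_left_cancel by blast
    qed
    have 2: "c * ?s ?g = ?s f - ?s (?t f)"
      using arg_cong[OF db, of ?s f] by (simp add: swap_vars_mult swap_vars.hom_minus act)
    have 3: "a * ?t (?s ?g) = ?t (?s f) - ?t (?s (?t f))"
      using arg_cong[OF 2, of ?t] by (simp add: swap_vars_mult swap_vars.hom_minus act)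
    have "a * b * c * divided_diff (Suc i) (divided_diff i ?g)
        = c * ?g - a * ?g - c * ?s ?g + a * ?t (?s ?g)"
      unfolding scaled_ts 1 by (simp add: algebra_simps)
    also have "\<dots> = b * ?g - c * ?s ?g + a * ?t (?s ?g)"
      unfolding ab[symmetric] by (simp add: algebra_simps)
    finally show ?thesis unfolding 2 3 db by simp
  qed
  have "a * b * c * divided_diff i (divided_diff (Suc i) (divided_diff i f))
      = a * b * c * divided_diff (Suc i) (divided_diff i (divided_diff (Suc i) f))"
    unfolding L R swap_vars_braid ..
  moreover have "a * b * c \<noteq> 0" using ne by simp
  ultimately show ?thesis using mult_left_cancel by blast
qed

text \<open>
  The value of a polynomial at \<open>x\<^sub>1 = x\<^sub>2 = \<dots> = 1\<close> is the sum of its coefficients.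
\<close>

definition eval1 :: "mpoly \<Rightarrow> int" where
  "eval1 f = (\<Sum>m\<in>Poly_Mapping.keys f. Poly_Mapping.lookup f m)"

lemma eval_mpoly_1: "eval_mpoly (\<lambda>_. 1) = eval1"
  by (simp add: fun_eq_iff eval_mpoly_def eval1_def)

lemma eval1_single [simp]: "eval1 (Poly_Mapping.single m c) = c"
  by (simp add: eval1_def)

lemma eval1_add: "eval1 (f + g) = eval1 f + eval1 g"
  unfolding eval1_def by (rule setsum_keys_plus_distrib) simp_all

lemma eval1_mult: "eval1 (f * g) = eval1 f * eval1 g"
proof (induction f rule: mpoly_induct)
  case (single m c)
  show ?case
    by (induction g rule: mpoly_induct) (simp_all add: mult_single eval1_add distrib_left)
next
  case (add f f')
  then show ?case by (simp add: distrib_right eval1_add)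
qed

interpretation eval1: comm_ring_hom eval1
  using eval1_single[of 0 0] eval1_single[of 0 1]
  by unfold_locales (simp_all add: eval1_add eval1_mult del: eval1_single)

lemma eval1_var [simp]: "eval1 (var i) = 1"
  by (simp add: var_def)

section \<open>Schubert polynomials do not depend on the chain of descents\<close>

lemma longest_perm_apply:
  "longest_perm n i = (if 1 \<le> i \<and> i \<le> n then Suc n - i else i)"
  by (auto simp: longest_perm_def one_line_def rev_nth simp del: upt_Suc)

lemma longest_perm_permutes: "longest_perm n permutes {1..n}"
  unfolding permutes_def
proof (intro conjI allI impI)
  fix y
  show "\<exists>!x. longest_perm n x = y"
    by (rule ex1I[of _ "longest_perm n y"]) (auto simp: longest_perm_apply split: if_splits)
qed (auto simp: longest_perm_apply)

lemma adj_transp_permutes: "1 \<le> i \<Longrightarrow> i < n \<Longrightarrow> adj_transp i permutes {1..n}"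
  by (intro permutes_swap_id) auto

lemma inversions_subset:
  fixes n :: nat
  assumes "w permutes {1..n}"
  shows "{(i, j). i < j \<and> w j < w i} \<subseteq> {1..n} \<times> {1..n}"
proof clarify
  fix i j :: nat
  assume *: "i < j" "w j < w i"
  have in_n: "w x \<in> {1..n} \<longleftrightarrow> x \<in> {1..n}" for x
    using assms by (rule permutes_in_image)
  have out: "w x = x" if "x \<notin> {1..n}" for x
    using assms that by (rule permutes_not_in)
  show "i \<in> {1..n} \<and> j \<in> {1..n}"
    using * in_n[of i] in_n[of j] out[of i] out[of j] by (cases "i \<in> {1..n}"; cases "j \<in> {1..n}") auto
qed

lemma perm_length_le:
  assumes "w permutes {1..n}"
  shows "perm_length w \<le> n * n"
proof -
  have "perm_length w \<le> card ({1..n} \<times> {1..n})"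
    unfolding perm_length_def by (intro card_mono inversions_subset assms) auto
  then show ?thesis by simp
qed

text \<open>
  Exchanging the entries of an ascent adds the inversion \<open>(i, i + 1)\<close> and carries the old
  inversions bijectively to the other new ones, because \<open>s\<^sub>i\<close> preserves the order of every other pair
  of positions.
\<close>

lemma perm_length_ascent:
  assumes w: "w permutes {1..n}" and asc: "w i < w (Suc i)"
  shows "perm_length (w \<circ> adj_transp i) = Suc (perm_length w)"
proof -
  let ?I = "{(a, b). a < b \<and> w b < w a}"
  let ?s = "adj_transp i"
  have mono: "?s a < ?s b" if "a < b" "(a, b) \<noteq> (i, Suc i)" for a b
    using that by (auto simp: transpose_def)
  have "{(a, b). a < b \<and> (w \<circ> ?s) b < (w \<circ> ?s) a} = insert (i, Suc i) (map_prod ?s ?s ` ?I)"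
    (is "?L = ?R")
  proof (intro equalityI subrelI)
    fix a b
    assume "(a, b) \<in> ?L"
    then have ab: "a < b" "w (?s b) < w (?s a)" by auto
    show "(a, b) \<in> ?R"
    proof (cases "(a, b) = (i, Suc i)")
      case False
      with ab mono have "(?s a, ?s b) \<in> ?I" by simp
      then have "map_prod ?s ?s (?s a, ?s b) \<in> map_prod ?s ?s ` ?I" by (rule imageI)
      then show ?thesis by simp
    qed simp
  next
    fix a b
    assume "(a, b) \<in> ?R"
    then consider "a = i" "b = Suc i" | c d where "a = ?s c" "b = ?s d" "c < d" "w d < w c"
      by auto
    then show "(a, b) \<in> ?L"
    proof cases
      case 2
      with asc have "(c, d) \<noteq> (i, Suc i)" by auto
      with 2 mono show ?thesis by simp
    qed (use asc in simp)
  qed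
  moreover have "(i, Suc i) \<notin> map_prod ?s ?s ` ?I"
    by (auto simp: transpose_def split: if_splits)
  moreover have "finite ?I"
    using inversions_subset[OF w] by (rule finite_subset) simp
  moreover have "card (map_prod ?s ?s ` ?I) = card ?I"
    by (intro card_image inj_on_subset[OF prod.inj_map]) simp_all
  ultimately show ?thesis
    unfolding perm_length_def by simp
qed

lemma comp_adj_transp_twice [simp]: "w \<circ> adj_transp i \<circ> adj_transp i = w"
  by (simp add: comp_assoc)

text \<open>
  The length condition in the descent rule says that position \<open>i\<close> is a descent; all that follows
  uses it only in this form.
\<close>

lemma perm_length_descent_iff:
  assumes w: "w permutes {1..n}" and i: "1 \<le> i" "i < n"
  shows "perm_length w = Suc (perm_length (w \<circ> adj_transp i)) \<longleftrightarrow> w (Suc i) < w i"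
proof -
  have "w \<circ> adj_transp i permutes {1..n}"
    using permutes_compose[OF adj_transp_permutes[OF i] w] .
  from perm_length_ascent[OF this, of i] perm_length_ascent[OF w, of i]
  have "w (Suc i) < w i \<Longrightarrow> perm_length w = Suc (perm_length (w \<circ> adj_transp i))"
    "w i < w (Suc i) \<Longrightarrow> perm_length (w \<circ> adj_transp i) = Suc (perm_length w)"
    by simp_all
  moreover have "w i \<noteq> w (Suc i)"
    using permutes_inj[OF w] by (simp add: inj_eq)
  ultimately show ?thesis by linarith
qed

lemma schubert_rel_permutes:
  "schubert_rel n w f \<Longrightarrow> w permutes {1..n}"
proof (induction rule: schubert_rel.induct)
  case longest
  show ?case by (rule longest_perm_permutes)
next
  case (step w f i)
  then show ?case by (intro permutes_compose[OF adj_transp_permutes]) 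
qed

lemma schubert_rel_step:
  assumes "schubert_rel n w f" "1 \<le> i" "i < n" "w (Suc i) < w i"
  shows "schubert_rel n (w \<circ> adj_transp i) (divided_diff i f)"
  using assms perm_length_descent_iff[OF schubert_rel_permutes]
  by (intro schubert_rel.step) auto

lemma schubert_rel_cases:
  assumes "schubert_rel n w f"
  obtains (longest) "w = longest_perm n" "f = (\<Prod>i = 1..<n. var i ^ (n - i))"
  | (step) i g where "1 \<le> i" "i < n" "w i < w (Suc i)"
      "schubert_rel n (w \<circ> adj_transp i) g" "f = divided_diff i g"
  using assms
proof cases
  case (step u g i)
  then have "u (Suc i) < u i"
    using perm_length_descent_iff[OF schubert_rel_permutes] by blast
  with step that(2)[of i g] show ?thesis by simp
qed (use that(1) in simp)

lemma perm_without_ascent: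
  assumes w: "w permutes {1..n}"
    and desc: "\<And>i. 1 \<le> i \<Longrightarrow> i < n \<Longrightarrow> w (Suc i) < w i"
  shows "w = longest_perm n"
proof
  fix i
  show "w i = longest_perm n i"
  proof (cases "1 \<le> i \<and> i \<le> n")
    case True
    then have i: "1 \<le> i" "i \<le> n" by simp_all
    have range: "1 \<le> w j" "w j \<le> n" if "1 \<le> j" "j \<le> n" for j
      using that permutes_in_image[OF w, of j] by simp_all
    have "w i + i \<le> Suc n"
      using i
    proof (induction i rule: dec_induct)
      case base
      then show ?case using range[of 1] by simp
    next
      case (step j)
      then show ?case using desc[of j] by simp
    qed
    moreover have "Suc n \<le> w i + i"
      using i(2,1)
    proof (induction i rule: inc_induct)
      case base
      then show ?case using range[of n] by simp
    next
      case (step j)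
      then show ?case using desc[of j] by simp
    qed
    ultimately show ?thesis using i by (simp add: longest_perm_apply)
  next
    case False
    then show ?thesis using permutes_not_in[OF w, of i] by (auto simp: longest_perm_apply)
  qed
qed

text \<open>
  As long as a permutation has an ascent, undoing it leads to a longer permutation; the process
  stops only at the longest one.
\<close>

lemma schubert_rel_exists:
  assumes "w permutes {1..n}"
  shows "\<exists>f. schubert_rel n w f"
  using assms
proof (induction "n * n - perm_length w" arbitrary: w rule: less_induct)
  case (less w)
  show ?case
  proof (cases "w = longest_perm n")
    case True
    then show ?thesis using schubert_rel.longest by blast
  next
    case False
    then obtain i where i: "1 \<le> i" "i < n" "\<not> w (Suc i) < w i"
      using perm_without_ascent[OF less.prems] by blast
    have "w i \<noteq> w (Suc i)"
      using permutes_inj[OF less.prems] by (simp add: inj_eq)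
    with i have asc: "w i < w (Suc i)" by simp
    let ?u = "w \<circ> adj_transp i"
    have u: "?u permutes {1..n}"
      using permutes_compose[OF adj_transp_permutes[OF i(1,2)] less.prems] .
    have "n * n - perm_length ?u < n * n - perm_length w"
      using perm_length_le[OF u] perm_length_ascent[OF less.prems asc] by simp
    from less.hyps[OF this u] obtain f where "schubert_rel n ?u f" ..
    from schubert_rel_step[OF this i(1,2)] asc show ?thesis by auto
  qed
qed

text \<open>
  Induction from the longest permutation downwards. If \<open>w\<close> is reached through the ascents \<open>i\<close> and
  \<open>j\<close>, a longer permutation \<open>m\<close>, obtained from \<open>w\<close> by rearranging the entries at the positions
  \<open>i, i + 1, j, j + 1\<close>, lies above both predecessors. By induction their polynomials are those
  computed from \<open>m\<close>, and the two routes from \<open>m\<close> to \<open>w\<close> agree by the commutation relation or the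
  braid relation.
\<close>

lemma schubert_rel_unique:
  assumes "schubert_rel n w f" "schubert_rel n w g"
  shows "f = g"
  using assms
proof (induction "n * n - perm_length w" arbitrary: w f g rule: less_induct)
  case (less w f g)
  have w: "w permutes {1..n}" using less.prems schubert_rel_permutes by blast
  have IH: "f' = g'"
    if "1 \<le> i" "i < n" "w i < w (Suc i)"
      "schubert_rel n (w \<circ> adj_transp i) f'" "schubert_rel n (w \<circ> adj_transp i) g'" for i f' g'
  proof (rule less.hyps[OF _ that(4,5)])
    show "n * n - perm_length (w \<circ> adj_transp i) < n * n - perm_length w"
      using perm_length_le[OF schubert_rel_permutes[OF that(4)]] perm_length_ascent[OF w that(3)]
      by simp
  qed
  have less_case: "divided_diff i f' = divided_diff j g'"
    if i: "1 \<le> i" "i < n" "w i < w (Suc i)" and j: "1 \<le> j" "j < n" "w j < w (Suc j)"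
      and f': "schubert_rel n (w \<circ> adj_transp i) f'"
      and g': "schubert_rel n (w \<circ> adj_transp j) g'"
      and "i < j" for i j f' g'
  proof (cases "j = Suc i")
    case True
    let ?m = "w \<circ> adj_transp i \<circ> adj_transp j \<circ> adj_transp i"
    have m: "?m permutes {1..n}"
      by (intro permutes_compose adj_transp_permutes w i j)
    then obtain h where h: "schubert_rel n ?m h" using schubert_rel_exists by blast
    have "schubert_rel n (?m \<circ> adj_transp i \<circ> adj_transp j) (divided_diff j (divided_diff i h))"
      using i j True
      by (intro schubert_rel_step h) (auto simp: transpose_def)
    moreover have "?m \<circ> adj_transp i \<circ> adj_transp j = w \<circ> adj_transp i" by simp
    ultimately have "f' = divided_diff j (divided_diff i h)"
      using IH[OF i f'] by simp
    moreover have "schubert_rel n (?m \<circ> adj_transp j \<circ> adj_transp i) (divided_diff i (divided_diff j h))"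
      using i j True
      by (intro schubert_rel_step h) (auto simp: transpose_def)
    moreover have "?m \<circ> adj_transp j \<circ> adj_transp i = w \<circ> adj_transp j"
      using True by (auto simp: fun_eq_iff transpose_def)
    ultimately have "g' = divided_diff i (divided_diff j h)"
      using IH[OF j g'] by simp
    with \<open>f' = _\<close> show ?thesis using divided_diff_braid True by simp
  next
    case False
    with \<open>i < j\<close> have far: "Suc i < j" by simp
    let ?m = "w \<circ> adj_transp i \<circ> adj_transp j"
    have m: "?m permutes {1..n}"
      by (intro permutes_compose adj_transp_permutes w i j)
    then obtain h where h: "schubert_rel n ?m h" using schubert_rel_exists by blast
    have "schubert_rel n (?m \<circ> adj_transp j) (divided_diff j h)"
      using i j far by (intro schubert_rel_step h) (auto simp: transpose_def)
    then have "f' = divided_diff j h"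
      using IH[OF i f'] by simp
    moreover have "schubert_rel n (?m \<circ> adj_transp i) (divided_diff i h)"
      using i j far by (intro schubert_rel_step h) (auto simp: transpose_def)
    moreover have "?m \<circ> adj_transp i = w \<circ> adj_transp j"
      using far by (auto simp: fun_eq_iff transpose_def)
    ultimately have "g' = divided_diff i h"
      using IH[OF j g'] by simp
    with \<open>f' = _\<close> show ?thesis using divided_diff_commute[OF far] by simp
  qed
  have not_longest: "w \<noteq> longest_perm n" if "1 \<le> i" "i < n" "w i < w (Suc i)" for i
    using that by (auto simp: longest_perm_apply)
  show ?case
    using less.prems(1)
  proof (cases rule: schubert_rel_cases)
    case f: longest
    show ?thesis
      using less.prems(2) by (cases rule: schubert_rel_cases) (use f not_longest in auto)
  next
    case f: (step i f')
    from less.prems(2) show ?thesis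
    proof (cases rule: schubert_rel_cases)
      case longest
      then show ?thesis using f not_longest by blast
    next
      case g: (step j g')
      consider "i < j" | "j < i" | "i = j" by linarith
      then show ?thesis
      proof cases
        case 1
        then show ?thesis using less_case f g by simp
      next
        case 2
        then show ?thesis using less_case[OF g(1-3) f(1-3) g(4) f(4)] f(5) g(5) by simp
      next
        case 3
        then show ?thesis using IH[OF f(1-4)] f(5) g by simp
      qed
    qed
  qed
qed

lemma schubert_eqI: "schubert_rel n w f \<Longrightarrow> schubert n w = f"
  unfolding schubert_def using schubert_rel_unique by blast

section \<open>Determinants of complete homogeneous polynomials\<close>

text \<open>
  \<open>hsym y p q\<close> is the complete homogeneous polynomial of degree \<open>q - p\<close> in \<open>y\<^sub>1, \<dots>, y\<^sub>p\<close>, and \<open>0\<close> if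
  \<open>q < p\<close>. Indexing by \<open>q\<close>, the sum of the degree and the number of variables, makes the divided
  difference act on \<open>p\<close> alone, since it lowers the degree by one and adds one variable; so it keeps
  each entry of a determinant in its column.
\<close>

fun hsym :: "(nat \<Rightarrow> 'a::comm_ring_1) \<Rightarrow> nat \<Rightarrow> nat \<Rightarrow> 'a" where
  "hsym y 0 q = (if q = 0 then 1 else 0)"
| "hsym y (Suc p) 0 = 0"
| "hsym y (Suc p) (Suc q) = hsym y p q + y (Suc p) * hsym y (Suc p) q"

lemma (in comm_ring_hom) hom_hsym: "hom (hsym y p q) = hsym (\<lambda>i. hom (y i)) p q"
  by (induction y p q rule: hsym.induct) (simp_all add: hom_distribs)

lemma hsym_one: "hsym (\<lambda>_. 1) (Suc p) (Suc q) = (of_nat (q choose p) :: 'a::comm_ring_1)"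
proof (induction q arbitrary: p)
  case 0
  show ?case by (cases p) simp_all
next
  case (Suc q)
  have "hsym (\<lambda>_. 1) (Suc p) (Suc (Suc q)) = hsym (\<lambda>_. 1::'a) p (Suc q) + hsym (\<lambda>_. 1) (Suc p) (Suc q)"
    by simp
  then show ?case unfolding Suc.IH by (cases p) (simp_all add: Suc.IH del: hsym.simps(3))
qed

lemma hsym_cong: "(\<And>i. 1 \<le> i \<Longrightarrow> i \<le> p \<Longrightarrow> y i = z i) \<Longrightarrow> hsym y p q = hsym z p q"
  by (induction y p q rule: hsym.induct) simp_all

lemma hsym_single_variable: "hsym y 1 (Suc q) = y 1 ^ q"
  by (induction q) simp_all

text \<open>
  Multiplying the generating function of the complete homogeneous polynomials by \<open>1 - y\<^sub>1 t\<close>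
  removes the variable \<open>y\<^sub>1\<close>.
\<close>

lemma hsym_remove_first:
  "hsym y (Suc p) (Suc q) - y 1 * hsym y (Suc p) q = hsym (\<lambda>i. y (Suc i)) p q"
proof (induction p arbitrary: q)
  case 0
  show ?case by simp
next
  case (Suc p)
  show ?case
  proof (induction q)
    case 0
    show ?case by simp
  next
    case (Suc q)
    have "hsym y (Suc (Suc p)) (Suc (Suc q)) - y 1 * hsym y (Suc (Suc p)) (Suc q)
      = (hsym y (Suc p) (Suc q) - y 1 * hsym y (Suc p) q)
        + y (Suc (Suc p)) * (hsym y (Suc (Suc p)) (Suc q) - y 1 * hsym y (Suc (Suc p)) q)"
      by (simp add: algebra_simps)
    then show ?case unfolding Suc.IH Suc \<open>\<And>q. _ = hsym _ p q\<close> by simp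
  qed
qed

lemma prod_list_diag_mat: "prod_list (diag_mat A) = (\<Prod>i<dim_row A. A $$ (i, i))"
  by (simp add: diag_mat_def prod.list_conv_set_nth atLeast0LessThan)

lemma det_first_row_unit:
  fixes A :: "'a::comm_ring_1 mat"
  assumes A: "A \<in> carrier_mat (Suc N) (Suc N)"
    and row: "\<And>j. 0 < j \<Longrightarrow> j \<le> N \<Longrightarrow> A $$ (0, j) = 0"
  shows "det A = A $$ (0, 0) * det (mat N N (\<lambda>(i, j). A $$ (Suc i, Suc j)))"
proof -
  have "det A = (\<Sum>j<Suc N. A $$ (0, j) * cofactor A 0 j)"
    by (rule laplace_expansion_row[OF A]) simp
  also have "\<dots> = A $$ (0, 0) * cofactor A 0 0"
    by (subst sum.lessThan_Suc_shift) (simp add: row)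
  also have "mat_delete A 0 0 = mat N N (\<lambda>(i, j). A $$ (Suc i, Suc j))"
    using A by (auto simp: mat_delete_def)
  then have "cofactor A 0 0 = det (mat N N (\<lambda>(i, j). A $$ (Suc i, Suc j)))"
    by (simp add: cofactor_def)
  finally show ?thesis .
qed

lemma det_mat_cong:
  "(\<And>i j. i < n \<Longrightarrow> j < n \<Longrightarrow> f i j = g i j) \<Longrightarrow> det (mat n n (\<lambda>(i, j). f i j)) = det (mat n n (\<lambda>(i, j). g i j))"
  by (intro arg_cong[of _ _ det] eq_matI) auto

text \<open>
  Subtracting from each column \<open>y\<^sub>1\<close> times its left neighbour removes \<open>y\<^sub>1\<close> from all columns but the
  first. The first row then has no variables left and vanishes beyond its first entry
  \<open>y\<^sub>1\<close> to the power \<open>N\<close>, and the remaining minor is the same determinant in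
  \<open>y\<^sub>2, y\<^sub>3, \<dots>\<close>.
\<close>

lemma det_hsym_staircase:
  "det (mat N N (\<lambda>(a, b). hsym y (Suc a) (Suc N - a + b))) = (\<Prod>i = 1..<Suc N. y i ^ (Suc N - i))"
proof (induction N arbitrary: y)
  case 0
  show ?case by simp
next
  case (Suc N)
  let ?n = "Suc N"
  let ?M = "mat ?n ?n (\<lambda>(a, b). hsym y (Suc a) (Suc ?n - a + b))"
  define U where "U = mat ?n ?n (\<lambda>(l, b). (if l = b then 1 else 0) - (if Suc l = b then y 1 else 0))"
  have carr: "?M \<in> carrier_mat ?n ?n" "U \<in> carrier_mat ?n ?n" by (simp_all add: U_def)
  have "det U = prod_list (diag_mat U)"
    by (rule det_upper_triangular[OF _ carr(2)]) (auto simp: U_def upper_triangular_def)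
  also have "\<dots> = 1"
    by (simp add: prod_list_diag_mat U_def)
  finally have detU: "det U = 1" .
  have MU: "(?M * U) $$ (a, b) = (if b = 0 then hsym y (Suc a) (Suc ?n - a)
      else hsym (\<lambda>i. y (Suc i)) a (?n - a + b))" if "a < ?n" "b < ?n" for a b
  proof -
    have "(?M * U) $$ (a, b)
        = (\<Sum>l = 0..<?n. hsym y (Suc a) (Suc ?n - a + l) *
            ((if l = b then 1 else 0) - (if Suc l = b then y 1 else 0)))"
      using that by (simp add: U_def scalar_prod_def del: hsym.simps sum.op_ivl_Suc)
    also have "\<dots> = (\<Sum>l = 0..<?n. if l = b then hsym y (Suc a) (Suc ?n - a + l) else 0)
         - (\<Sum>l = 0..<?n. if Suc l = b then y 1 * hsym y (Suc a) (Suc ?n - a + l) else 0)"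
      unfolding sum_subtractf[symmetric] by (intro sum.cong refl) (simp add: algebra_simps del: hsym.simps)
    also have "\<dots> = (if b = 0 then hsym y (Suc a) (Suc ?n - a)
        else hsym y (Suc a) (Suc ?n - a + b) - y 1 * hsym y (Suc a) (?n - a + b))"
    proof (cases b)
      case 0
      then show ?thesis by (simp del: hsym.simps sum.op_ivl_Suc)
    next
      case (Suc b')
      then show ?thesis using that by (simp add: Suc_diff_le del: hsym.simps sum.op_ivl_Suc)
    qed
    also have "Suc ?n - a + b = Suc (?n - a + b)" using that by simp
    finally show ?thesis unfolding hsym_remove_first .
  qed
  have "det ?M = det (?M * U)"
    using det_mult[OF carr] detU by simp
  also have "\<dots> = (?M * U) $$ (0, 0) * det (mat N N (\<lambda>(i, j). (?M * U) $$ (Suc i, Suc j)))"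
  proof (rule det_first_row_unit[OF mult_carrier_mat[OF carr]])
    fix b assume "0 < b" "b \<le> N"
    then show "(?M * U) $$ (0, b) = 0" by (subst MU) simp_all
  qed
  also have "mat N N (\<lambda>(i, j). (?M * U) $$ (Suc i, Suc j))
      = mat N N (\<lambda>(a, b). hsym (\<lambda>i. y (Suc i)) (Suc a) (Suc N - a + b))"
    by (intro eq_matI) (simp_all add: MU Suc_diff_le del: hsym.simps index_mult_mat(1))
  also have "(?M * U) $$ (0, 0) = y 1 ^ ?n"
    using hsym_single_variable[of y ?n] by (simp add: MU del: hsym.simps index_mult_mat(1))
  also have "y 1 ^ ?n * det (mat N N (\<lambda>(a, b). hsym (\<lambda>i. y (Suc i)) (Suc a) (Suc N - a + b)))
      = y 1 ^ ?n * (\<Prod>i = 1..<Suc N. y (Suc i) ^ (Suc N - i))"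
    unfolding Suc.IH ..
  also have "\<dots> = (\<Prod>i = 1..<Suc ?n. y i ^ (Suc ?n - i))"
    by (subst prod.atLeast_Suc_lessThan) (simp_all add: prod.shift_bounds_Suc_ivl del: prod.op_ivl_Suc)
  finally show ?case .
qed

text \<open>
  This says that \<open>\<partial>\<^sub>p\<^sub>+\<^sub>1\<close> takes \<open>hsym var (Suc p) q\<close> to \<open>hsym var (Suc (Suc p)) q\<close>. The
  induction is on \<open>q\<close> alone: the recursion also leads to polynomials in \<open>x\<^sub>1, \<dots>, x\<^sub>p\<close>, but the
  exchange fixes these.
\<close>

lemma hsym_var_diff:
  "(var (Suc p) - var (Suc (Suc p))) * hsym var (Suc (Suc p)) q
    = hsym var (Suc p) q - swap_vars (Suc p) (hsym var (Suc p) q)"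
proof (induction q)
  case 0
  show ?case by (simp add: swap_vars_0)
next
  case (Suc q)
  let ?x = "var (Suc p)" and ?z = "var (Suc (Suc p))" and ?s = "swap_vars (Suc p)"
  have "swap_vars (Suc p) (hsym var p q) = hsym (\<lambda>i. ?s (var i)) p q"
    by (rule swap_vars.hom_hsym)
  also have "\<dots> = hsym var p q"
    by (rule hsym_cong) (simp add: transpose_def)
  finally have fixed: "?s (hsym var p q) = hsym var p q" .
  have IH: "?s (hsym var (Suc p) q) = hsym var (Suc p) q - (?x - ?z) * hsym var (Suc (Suc p)) q"
    unfolding Suc.IH by simp
  have "hsym var (Suc p) (Suc q) - ?s (hsym var (Suc p) (Suc q))
      = ?x * hsym var (Suc p) q - ?z * ?s (hsym var (Suc p) q)"
    by (simp add: swap_vars_add swap_vars_mult fixed)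
  also have "\<dots> = (?x - ?z) * hsym var (Suc (Suc p)) (Suc q)"
    unfolding IH by (simp add: algebra_simps)
  finally show ?case by simp
qed

text \<open>
  For \<open>p = i + 1\<close>, the symmetry follows from \<open>hsym_var_diff\<close>, whose right-hand side changes
  sign under the exchange of \<open>x\<^sub>i\<close> and \<open>x\<^sub>i\<^sub>+\<^sub>1\<close>, as does the factor \<open>x\<^sub>i - x\<^sub>i\<^sub>+\<^sub>1\<close>; further variables do not
  disturb it.
\<close>

lemma swap_vars_hsym:
  assumes "1 \<le> i" "p \<noteq> i"
  shows "swap_vars i (hsym var p q) = hsym var p q"
proof (cases "p < i")
  case True
  have "swap_vars i (hsym var p q) = hsym (\<lambda>j. swap_vars i (var j)) p q"
    by (rule swap_vars.hom_hsym)
  also have "\<dots> = hsym var p q"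
    using True by (intro hsym_cong) (simp add: transpose_def)
  finally show ?thesis .
next
  case False
  with assms have "Suc i \<le> p" by simp
  then show ?thesis
  proof (induction arbitrary: q rule: dec_induct)
    case base
    from \<open>1 \<le> i\<close> obtain k where i: "i = Suc k" by (cases i) auto
    let ?h = "hsym var (Suc i) q" and ?d = "var i - var (Suc i)"
    have *: "?d * ?h = hsym var i q - swap_vars i (hsym var i q)"
      using hsym_var_diff[of k q] i by simp
    have "swap_vars i ?d * swap_vars i ?h = swap_vars i (hsym var i q) - hsym var i q"
      using arg_cong[OF *, of "swap_vars i"] by (simp add: swap_vars_mult swap_vars.hom_minus)
    moreover have "swap_vars i ?d = - ?d"
      by (simp add: swap_vars.hom_minus)
    ultimately have "- (?d * swap_vars i ?h) = - (?d * ?h)"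
      by (simp only: mult_minus_left * minus_diff_eq[of "hsym var i q"])
    then have eq: "?d * swap_vars i ?h = ?d * ?h" by (simp only: neg_equal_iff_equal)
    have "?d \<noteq> 0" by (rule var_diff_nonzero) simp
    from iffD1[OF mult_left_cancel[OF this] eq] show ?case .
  next
    case (step p)
    show ?case
    proof (induction q)
      case (Suc q)
      have "adj_transp i (Suc p) = Suc p"
        using step.hyps by (simp add: transpose_def)
      then show ?case
        by (simp add: swap_vars_add swap_vars_mult step.IH Suc.IH)
    qed (simp add: swap_vars_0)
  qed
qed

text \<open>
  A Jacobi-Trudi determinant with flags: row \<open>a\<close> uses the variables \<open>x\<^sub>1, \<dots>, x\<^sub>p\<close> for the flag
  \<open>p = \<phi> a\<close>.
\<close>

definition hsym_det :: "nat \<Rightarrow> (nat \<Rightarrow> nat) \<Rightarrow> mpoly" where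
  "hsym_det N \<phi> = det (mat N N (\<lambda>(a, b). hsym var (\<phi> a) (Suc N - a + b)))"

text \<open>
  All rows other than \<open>r\<close> are symmetric in the two variables that the divided difference
  involves, so they act as constants in the expansion of the determinant along row \<open>r\<close>.
\<close>

lemma divided_diff_hsym_det:
  assumes r: "r < N" and p: "1 \<le> \<phi> r"
    and only: "\<And>a. a < N \<Longrightarrow> a \<noteq> r \<Longrightarrow> \<phi> a \<noteq> \<phi> r"
  shows "divided_diff (\<phi> r) (hsym_det N \<phi>) = hsym_det N (\<phi>(r := Suc (\<phi> r)))"
proof (rule divided_diff_eqI)
  let ?p = "\<phi> r"
  let ?A = "mat N N (\<lambda>(a, b). hsym var (\<phi> a) (Suc N - a + b))"
  let ?B = "mat N N (\<lambda>(a, b). hsym var ((\<phi>(r := Suc (\<phi> r))) a) (Suc N - a + b))"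
  let ?S = "map_mat (swap_vars ?p) ?A"
  have carr: "?A \<in> carrier_mat N N" "?B \<in> carrier_mat N N" "?S \<in> carrier_mat N N" by simp_all
  have cofactors: "cofactor ?B r b = cofactor ?A r b" "cofactor ?S r b = cofactor ?A r b" if "b < N" for b
  proof -
    have "mat_delete ?B r b = mat_delete ?A r b"
      unfolding mat_delete_def by (intro eq_matI) auto
    then show "cofactor ?B r b = cofactor ?A r b" by (simp add: cofactor_def)
    have "mat_delete ?S r b = mat_delete ?A r b"
      unfolding mat_delete_def using p only by (intro eq_matI) (auto simp: swap_vars_hsym)
    then show "cofactor ?S r b = cofactor ?A r b" by (simp add: cofactor_def)
  qed
  from p obtain k where k: "?p = Suc k" by (cases ?p) auto
  have entry: "(var ?p - var (Suc ?p)) * hsym var (Suc ?p) q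
      = hsym var ?p q - swap_vars ?p (hsym var ?p q)" for q
    using hsym_var_diff[of k q] unfolding k .
  have "(var ?p - var (Suc ?p)) * det ?B
      = (\<Sum>b<N. (var ?p - var (Suc ?p)) * (?B $$ (r, b) * cofactor ?B r b))"
    unfolding laplace_expansion_row[OF carr(2) r] sum_distrib_left ..
  also have "\<dots> = (\<Sum>b<N. ?A $$ (r, b) * cofactor ?A r b - ?S $$ (r, b) * cofactor ?S r b)"
  proof (intro sum.cong refl)
    fix b assume "b \<in> {..<N}"
    then have b: "b < N" by simp
    have "(var ?p - var (Suc ?p)) * (?B $$ (r, b) * cofactor ?B r b)
      = ((var ?p - var (Suc ?p)) * hsym var (Suc ?p) (Suc N - r + b)) * cofactor ?A r b"
      unfolding cofactors(1)[OF b] using r b by (simp only: index_mat mult.assoc split fun_upd_same)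
    also have "\<dots> = ?A $$ (r, b) * cofactor ?A r b - ?S $$ (r, b) * cofactor ?S r b"
      unfolding entry cofactors(2)[OF b] using r b by (simp add: left_diff_distrib)
    finally show "(var ?p - var (Suc ?p)) * (?B $$ (r, b) * cofactor ?B r b)
        = ?A $$ (r, b) * cofactor ?A r b - ?S $$ (r, b) * cofactor ?S r b" .
  qed
  also have "\<dots> = det ?A - det ?S"
    unfolding laplace_expansion_row[OF carr(1) r] laplace_expansion_row[OF carr(3) r] sum_subtractf ..
  also have "det ?S = swap_vars ?p (det ?A)" by (rule swap_vars.hom_det)
  finally show "(var ?p - var (Suc ?p)) * hsym_det N (\<phi>(r := Suc (\<phi> r)))
      = hsym_det N \<phi> - swap_vars ?p (hsym_det N \<phi>)"
    unfolding hsym_det_def .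
qed

section \<open>The Schubert polynomial of a zigzag permutation\<close>

definition evens :: "nat \<Rightarrow> nat list" where
  "evens m = map (\<lambda>i. 2 * i) [1..<Suc (m div 2)]"

definition odds_desc :: "nat \<Rightarrow> nat list" where
  "odds_desc m = rev (map (\<lambda>i. 2 * i - 1) [1..<Suc (Suc m div 2)])"

definition zigzag :: "nat \<Rightarrow> nat list" where
  "zigzag m = evens m @ odds_desc m"

lemma zigzag_Suc: "zigzag (Suc m) = evens m @ Suc m # odds_desc m"
proof (cases "even m")
  case True
  then obtain k where m: "m = 2 * k" by (auto elim: evenE)
  have "Suc m div 2 = k" "Suc (Suc m) div 2 = Suc k" "m div 2 = k" using m by simp_all
  then show ?thesis by (simp add: zigzag_def evens_def odds_desc_def m)
next
  case False
  then obtain k where m: "m = 2 * k + 1" by (auto elim: oddE)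
  have "Suc m div 2 = Suc k" "Suc (Suc m) div 2 = Suc k" "m div 2 = k" using m by simp_all
  then show ?thesis by (simp add: zigzag_def evens_def odds_desc_def m)
qed

lemma length_evens: "length (evens m) = m div 2"
  by (simp add: evens_def)

lemma evens_le: "y \<in> set (evens m) \<Longrightarrow> y \<le> m"
  by (auto simp: evens_def)

lemma one_line_swap:
  "one_line (xs @ x # y # ys) \<circ> adj_transp (Suc (length xs)) = one_line (xs @ y # x # ys)"
proof
  fix i
  consider "i = Suc (length xs)" | "i = Suc (Suc (length xs))"
    | "i \<noteq> Suc (length xs)" "i \<noteq> Suc (Suc (length xs))" by blast
  then show "(one_line (xs @ x # y # ys) \<circ> adj_transp (Suc (length xs))) i
      = one_line (xs @ y # x # ys) i"
    by cases (auto simp: one_line_def nth_append nth_Cons transpose_def split: nat.splits)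
qed

lemma schubert_rel_swap:
  assumes "schubert_rel n (one_line (xs @ x # y # ys)) f" "y < x" "Suc (length xs) < n"
  shows "schubert_rel n (one_line (xs @ y # x # ys)) (divided_diff (Suc (length xs)) f)"
proof -
  have "schubert_rel n (one_line (xs @ x # y # ys) \<circ> adj_transp (Suc (length xs)))
      (divided_diff (Suc (length xs)) f)"
    by (rule schubert_rel_step[OF assms(1) _ assms(3)])
      (use assms(2) in \<open>auto simp: one_line_def nth_append\<close>)
  then show ?thesis by (simp only: one_line_swap)
qed

text \<open>
  Moving the entry \<open>x\<close> to the right one position at a time raises the flag of row \<open>r\<close>, which is the
  position of \<open>x\<close>. The last hypothesis keeps the flags of all other rows away from the positions
  that \<open>x\<close> passes.
\<close>

lemma schubert_rel_move_right:
  assumes "schubert_rel n (one_line (xs @ x # ys @ zs)) (hsym_det N \<phi>)"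
    and "\<And>y. y \<in> set ys \<Longrightarrow> y < x"
    and "length xs + length ys < n"
    and "r < N" "\<phi> r = Suc (length xs)"
    and "\<And>a. a < N \<Longrightarrow> a \<noteq> r \<Longrightarrow> \<phi> a \<le> length xs \<or> \<phi> a > length xs + length ys"
  shows "schubert_rel n (one_line (xs @ ys @ x # zs))
    (hsym_det N (\<phi>(r := Suc (length xs + length ys))))"
  using assms
proof (induction ys arbitrary: xs \<phi>)
  case Nil
  then have "\<phi>(r := Suc (length xs)) = \<phi>" by auto
  then show ?case using Nil by simp
next
  case (Cons y ys)
  let ?\<phi> = "\<phi>(r := Suc (Suc (length xs)))"
  have dd: "divided_diff (Suc (length xs)) (hsym_det N \<phi>) = hsym_det N ?\<phi>"
  proof -
    have "\<phi> a \<noteq> \<phi> r" if "a < N" "a \<noteq> r" for a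
      using Cons.prems(6)[OF that] Cons.prems(5) by auto
    from divided_diff_hsym_det[where \<phi> = \<phi>, OF Cons.prems(4) _ this] show ?thesis
      unfolding Cons.prems(5) by simp
  qed
  have "schubert_rel n (one_line (xs @ y # x # ys @ zs))
      (divided_diff (Suc (length xs)) (hsym_det N \<phi>))"
    using Cons.prems(1,2,3) by (intro schubert_rel_swap) auto
  then have "schubert_rel n (one_line ((xs @ [y]) @ x # ys @ zs)) (hsym_det N ?\<phi>)"
    unfolding dd by simp
  then have "schubert_rel n (one_line ((xs @ [y]) @ ys @ x # zs))
      (hsym_det N (?\<phi>(r := Suc (length (xs @ [y]) + length ys))))"
  proof (rule Cons.IH)
    show "?\<phi> a \<le> length (xs @ [y]) \<or> length (xs @ [y]) + length ys < ?\<phi> a"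
      if "a < N" "a \<noteq> r" for a
      using Cons.prems(6)[OF that] that by auto
  qed (use Cons.prems(2-4) in simp_all)
  moreover have "?\<phi>(r := Suc (length (xs @ [y]) + length ys))
      = \<phi>(r := Suc (length xs + length (y # ys)))"
    by simp
  ultimately show ?case by (simp only: append.simps append_assoc)
qed

text \<open>
  The entries of the longest permutation that exceed \<open>d + 1\<close> are still in place, the smaller ones are
  already in zigzag order; correspondingly the first \<open>N - d\<close> rows still have their initial flags and
  the others have the final ones. The next step takes \<open>d + 2\<close> past the even numbers up to \<open>d + 1\<close>.
\<close>

lemma schubert_rel_zigzag_suffix:
  assumes "d \<le> N"
  shows "schubert_rel (Suc N) (one_line (rev [Suc (Suc d)..<Suc (Suc N)] @ zigzag (Suc d)))
    (hsym_det N (\<lambda>a. if a < N - d then Suc a else Suc ((N + a) div 2)))"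
  using assms
proof (induction d)
  case 0
  have "hsym_det N (\<lambda>a. if a < N - 0 then Suc a else Suc ((N + a) div 2))
      = det (mat N N (\<lambda>(a, b). hsym var (Suc a) (Suc N - a + b)))"
    unfolding hsym_det_def by (rule det_mat_cong) simp
  also have "\<dots> = (\<Prod>i = 1..<Suc N. var i ^ (Suc N - i))"
    by (rule det_hsym_staircase)
  finally have det: "hsym_det N (\<lambda>a. if a < N - 0 then Suc a else Suc ((N + a) div 2))
    = (\<Prod>i = 1..<Suc N. var i ^ (Suc N - i))" .
  have "[1..<Suc (Suc N)] = 1 # [Suc (Suc 0)..<Suc (Suc N)]"
    by (subst upt_rec) simp
  moreover have "zigzag (Suc 0) = [1]"
    by (simp add: zigzag_def evens_def odds_desc_def)
  ultimately have "one_line (rev [Suc (Suc 0)..<Suc (Suc N)] @ zigzag (Suc 0)) = longest_perm (Suc N)"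
    by (simp only: longest_perm_def rev.simps append_assoc append.simps)
  with det show ?case using schubert_rel.longest[of "Suc N"] by simp
next
  case (Suc d)
  define m where "m = Suc d"
  define r where "r = N - m"
  let ?xs = "rev [Suc (Suc m)..<Suc (Suc N)]"
  let ?\<phi> = "\<lambda>a. if a < N - d then Suc a else Suc ((N + a) div 2)"
  have N: "N = r + m" and len: "length ?xs = r" and d: "N - d = Suc r"
    using Suc.prems by (simp_all add: r_def m_def del: upt_Suc)
  have "[Suc (Suc d)..<Suc (Suc N)] = Suc m # [Suc (Suc m)..<Suc (Suc N)]"
    using Suc.prems unfolding m_def by (subst upt_rec) simp
  then have "rev [Suc (Suc d)..<Suc (Suc N)] @ zigzag (Suc d)
      = ?xs @ Suc m # evens m @ odds_desc m"
    by (simp add: m_def zigzag_def)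
  with Suc have IH: "schubert_rel (Suc N) (one_line (?xs @ Suc m # evens m @ odds_desc m)) (hsym_det N ?\<phi>)"
    by simp
  have "schubert_rel (Suc N) (one_line (?xs @ evens m @ Suc m # odds_desc m))
      (hsym_det N (?\<phi>(r := Suc (length ?xs + length (evens m)))))"
  proof (rule schubert_rel_move_right[OF IH])
    show "y < Suc m" if "y \<in> set (evens m)" for y
      using evens_le[OF that] by simp
    show "length ?xs + length (evens m) < Suc N"
      unfolding len length_evens using N by simp
    show "r < N" using N by (simp add: m_def)
    show "?\<phi> r = Suc (length ?xs)" unfolding len by (simp add: d)
    show "?\<phi> a \<le> length ?xs \<or> length ?xs + length (evens m) < ?\<phi> a" if "a < N" "a \<noteq> r" for a
      unfolding len length_evens d using that N by auto
  qed
  moreover have "?xs @ evens m @ Suc m # odds_desc m = ?xs @ zigzag (Suc m)"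
    by (simp add: zigzag_Suc)
  moreover have "?\<phi>(r := Suc (length ?xs + length (evens m)))
      = (\<lambda>a. if a < N - Suc d then Suc a else Suc ((N + a) div 2))"
  proof
    fix a
    have d': "N - Suc d = r" by (simp add: r_def m_def)
    have "(N + r) div 2 = r + m div 2" using N by simp
    moreover consider "a < r" | "a = r" | "r < a" by linarith
    ultimately show "(?\<phi>(r := Suc (length ?xs + length (evens m)))) a
        = (if a < N - Suc d then Suc a else Suc ((N + a) div 2))"
      unfolding len length_evens d d' by cases simp_all
  qed
  ultimately show ?case by (simp only: m_def)
qed

lemma schubert_zigzag:
  "schubert (Suc N) (one_line (zigzag (Suc N))) = hsym_det N (\<lambda>a. Suc ((N + a) div 2))"
  using schubert_rel_zigzag_suffix[of N N] by (intro schubert_eqI) simp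

lemma eval1_schubert_zigzag:
  "eval1 (schubert (Suc N) (one_line (zigzag (Suc N))))
    = det (mat N N (\<lambda>(a, b). of_nat ((N - a + b) choose ((N + a) div 2))))"
proof -
  have "eval1 (hsym_det N (\<lambda>a. Suc ((N + a) div 2)))
      = det (map_mat eval1 (mat N N (\<lambda>(a, b). hsym var (Suc ((N + a) div 2)) (Suc N - a + b))))"
    unfolding hsym_det_def by (rule eval1.hom_det[symmetric])
  also have "map_mat eval1 (mat N N (\<lambda>(a, b). hsym var (Suc ((N + a) div 2)) (Suc N - a + b)))
      = mat N N (\<lambda>(a, b). of_nat ((N - a + b) choose ((N + a) div 2)))"
  proof (rule eq_matI)
    fix a b
    assume "a < dim_row (mat N N (\<lambda>(a, b). of_nat ((N - a + b) choose ((N + a) div 2))))"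
      "b < dim_col (mat N N (\<lambda>(a, b). of_nat ((N - a + b) choose ((N + a) div 2))))"
    then have ab: "a < N" "b < N" by simp_all
    then have "Suc N - a + b = Suc (N - a + b)" by simp
    then show "map_mat eval1 (mat N N (\<lambda>(a, b). hsym var (Suc ((N + a) div 2)) (Suc N - a + b))) $$ (a, b)
      = mat N N (\<lambda>(a, b). of_nat ((N - a + b) choose ((N + a) div 2))) $$ (a, b)"
      using ab by (simp add: eval1.hom_hsym hsym_one del: hsym.simps)
  qed simp_all
  finally show ?thesis unfolding schubert_zigzag .
qed

section \<open>Evaluation of the determinant at one\<close>

text \<open>
  \<open>gauss_coeff i\<close> is the coefficient sequence of the hypergeometric series
  \<open>G\<^sub>i = \<^sub>2F\<^sub>1(\<alpha>, 1 + i - \<alpha>; 1/2 + i; -27t/4)\<close> with \<open>\<alpha> = 2/3 + \<lfloor>i/2\<rfloor>\<close>. From \<open>G\<^sub>i\<close> to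
  \<open>G\<^sub>i\<^sub>+\<^sub>1\<close> the lower parameter and one of the upper parameters grow by one, the latter two taking
  turns, as in Gauss's continued fraction for a quotient of contiguous series.
\<close>

definition gauss_a :: "nat \<Rightarrow> rat" where
  "gauss_a i = 2 / 3 + of_nat (i div 2)"

definition gauss_coeff :: "nat \<Rightarrow> nat \<Rightarrow> rat" where
  "gauss_coeff i k = (- 27 / 4) ^ k * pochhammer (gauss_a i) k * pochhammer (1 + of_nat i - gauss_a i) k
    / (pochhammer (1 / 2 + of_nat i) k * fact k)"

text \<open>
  The numbers \<open>27/4 a (c - b) / (c (c + 1))\<close> for the parameters of \<open>G\<^sub>i\<close>, where \<open>c = 1/2 + i\<close> and
  \<open>b\<close> is the one of the upper parameters \<open>a\<close>, \<open>b\<close> that grows from \<open>G\<^sub>i\<close> to \<open>G\<^sub>i\<^sub>+\<^sub>1\<close>.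
\<close>

definition gauss_lam :: "nat \<Rightarrow> rat" where
  "gauss_lam i = (let m = of_nat (i div 2) in
     if even i then 3 / 2 * (3 * m + 2) * (6 * m + 1) / ((4 * m + 1) * (4 * m + 3))
     else 3 / 2 * (3 * m + 4) * (6 * m + 5) / ((4 * m + 3) * (4 * m + 5)))"

lemma gauss_coeff_0 [simp]: "gauss_coeff i 0 = 1"
  by (simp add: gauss_coeff_def)

text \<open>
  Gauss's contiguous relation
  \<open>F(a, b; c; z) - F(a, b+1; c+1; z) = - a (c - b) / (c (c + 1)) z F(a+1, b+1; c+2; z)\<close>,
  coefficient by coefficient.
\<close>

lemma hypergeometric_contiguity:
  fixes a b c :: rat
  assumes c: "c > 0"
  shows "pochhammer a (Suc k) * pochhammer b (Suc k) / (pochhammer c (Suc k) * fact (Suc k))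
    - pochhammer a (Suc k) * pochhammer (b + 1) (Suc k) / (pochhammer (c + 1) (Suc k) * fact (Suc k))
    = - (a * (c - b) / (c * (c + 1))) *
      (pochhammer (a + 1) k * pochhammer (b + 1) k / (pochhammer (c + 2) k * fact k))"
proof -
  define A where "A = pochhammer (a + 1) k"
  define B where "B = pochhammer (b + 1) k"
  define C where "C = pochhammer (c + 2) k"
  define f where "f = (fact k :: rat)"
  define x where "x = (of_nat k :: rat)"
  have pos: "C > 0" "f > 0" "x \<ge> 0"
    using c by (simp_all add: C_def f_def x_def pochhammer_pos)
  have "pochhammer (c + 1) (Suc k) = (c + 1) * C"
    by (simp add: pochhammer_rec C_def add.assoc)
  moreover have "pochhammer (c + 1) (Suc k) = pochhammer (c + 1) k * (c + 1 + x)"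
    by (simp add: pochhammer_Suc x_def)
  ultimately have Ck: "pochhammer (c + 1) k = (c + 1) * C / (c + 1 + x)"
    using c pos by (simp add: field_simps)
  have expand: "pochhammer a (Suc k) = a * A" "pochhammer b (Suc k) = b * B"
    "pochhammer (b + 1) (Suc k) = B * (b + 1 + x)"
    "pochhammer c (Suc k) = c * ((c + 1) * C / (c + 1 + x))"
    "pochhammer (c + 1) (Suc k) = (c + 1) * C" "fact (Suc k) = (x + 1) * f"
    unfolding Ck[symmetric]
    by (simp_all only: pochhammer_rec[of a] pochhammer_rec[of b] pochhammer_rec[of c]
        pochhammer_rec[of "c + 1"] pochhammer_Suc[of "b + 1"] A_def B_def C_def f_def x_def
        add.assoc one_add_one fact_Suc of_nat_Suc) (simp_all add: ac_simps)
  have "a * A * (b * B) / (c * ((c + 1) * C / (c + 1 + x)) * ((x + 1) * f))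
      - a * A * (B * (b + 1 + x)) / ((c + 1) * C * ((x + 1) * f))
      = a * A * B * (b * (c + 1 + x) - c * (b + 1 + x)) / (c * (c + 1) * C * ((x + 1) * f))"
  proof -
    have "a * A * (b * B) / (c * (d * C / D) * (e * f)) - a * A * (B * b') / (d * C * (e * f))
        = a * A * B * (b * D - c * b') / (c * d * C * (e * f))"
      if "d > 0" "D > 0" "e > 0" for d D e b' :: rat
      using c pos that by (simp add: field_simps)
    then show ?thesis using c pos by simp
  qed
  also have "b * (c + 1 + x) - c * (b + 1 + x) = (x + 1) * (b - c)"
    by (simp add: algebra_simps)
  also have "a * A * B * ((x + 1) * (b - c)) / (c * (c + 1) * C * ((x + 1) * f))
      = - (a * (c - b) / (c * (c + 1))) * (A * B / (C * f))"
    using c pos by (simp add: divide_simps) (simp add: algebra_simps)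
  finally show ?thesis
    unfolding expand A_def[symmetric] B_def[symmetric] C_def[symmetric] f_def[symmetric] .
qed

text \<open>
  The contiguous relation applied with \<open>z = -27t/4\<close>. The upper parameter that grows is
  \<open>1 + i - \<alpha>\<close> for even \<open>i\<close> and \<open>\<alpha>\<close> for odd \<open>i\<close>; the auxiliary fact \<open>scaled\<close> covers both by
  treating the two upper parameters as an unordered pair.
\<close>

lemma gauss_coeff_contiguity:
  "gauss_coeff i (Suc k) - gauss_coeff (Suc i) (Suc k) = gauss_lam i * gauss_coeff (Suc (Suc i)) k"
proof -
  have scaled: "gauss_coeff i (Suc k) - gauss_coeff (Suc i) (Suc k)
      = 27 / 4 * (a * (c - b) / (c * (c + 1))) * gauss_coeff (Suc (Suc i)) k"
    if "c = 1 / 2 + of_nat i"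
      and i0: "{gauss_a i, 1 + of_nat i - gauss_a i} = {a, b}"
      and i1: "{gauss_a (Suc i), 2 + of_nat i - gauss_a (Suc i)} = {a, b + 1}"
      and i2: "{gauss_a (Suc (Suc i)), 3 + of_nat i - gauss_a (Suc (Suc i))} = {a + 1, b + 1}"
    for a b c
  proof -
    have c: "c > 0" using that(1) by (simp add: add_pos_nonneg)
    have sym: "pochhammer x n * pochhammer y n = pochhammer a n * pochhammer b n"
      if "{x, y} = {a, b}" for x y a b :: rat and n
      using that by (auto simp: doubleton_eq_iff)
    have "gauss_coeff i (Suc k) = (- 27 / 4) ^ Suc k *
       (pochhammer a (Suc k) * pochhammer b (Suc k) / (pochhammer c (Suc k) * fact (Suc k)))"
      unfolding gauss_coeff_def that(1) sym[OF i0, symmetric] by (simp only: mult.assoc times_divide_eq_right)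
    moreover have "gauss_coeff (Suc i) (Suc k) = (- 27 / 4) ^ Suc k *
       (pochhammer a (Suc k) * pochhammer (b + 1) (Suc k) / (pochhammer (c + 1) (Suc k) * fact (Suc k)))"
      unfolding gauss_coeff_def that(1) sym[OF i1, symmetric]
      by (simp only: mult.assoc times_divide_eq_right) (simp add: add_ac del: pochhammer_Suc)
    moreover have "gauss_coeff (Suc (Suc i)) k = (- 27 / 4) ^ k *
       (pochhammer (a + 1) k * pochhammer (b + 1) k / (pochhammer (c + 2) k * fact k))"
      unfolding gauss_coeff_def that(1) sym[OF i2, symmetric]
      by (simp only: mult.assoc times_divide_eq_right) (simp add: add_ac)
    moreover have "(- 27 / 4) ^ Suc k * S - (- 27 / 4) ^ Suc k * T = 27 / 4 * L * ((- 27 / 4) ^ k * R)"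
      if "S - T = - L * R" for S T L R :: rat
      unfolding right_diff_distrib[symmetric] that by simp
    ultimately show ?thesis
      using hypergeometric_contiguity[OF c, of a k b] by metis
  qed
  show ?thesis
  proof (cases "even i")
    case True
    then obtain m where i: "i = 2 * m" by (auto elim: evenE)
    define x where "x = (of_nat m :: rat)"
    have x: "x \<ge> 0" by (simp add: x_def)
    have "27 / 4 * ((2 / 3 + x) * ((1 / 2 + 2 * x) - (1 / 3 + x)) / ((1 / 2 + 2 * x) * ((1 / 2 + 2 * x) + 1)))
        = gauss_lam i"
      unfolding gauss_lam_def Let_def i x_def[symmetric]
      using x by (simp add: x_def[symmetric] divide_simps add_nonneg_eq_0_iff) (simp add: algebra_simps)
    then show ?thesis
      by (subst scaled[of "1 / 2 + 2 * x" "2 / 3 + x" "1 / 3 + x"])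
        (simp_all add: i gauss_a_def x_def doubleton_eq_iff)
  next
    case False
    then obtain m where i: "i = 2 * m + 1" by (auto elim: oddE)
    define x where "x = (of_nat m :: rat)"
    have x: "x \<ge> 0" by (simp add: x_def)
    have "27 / 4 * ((4 / 3 + x) * ((3 / 2 + 2 * x) - (2 / 3 + x)) / ((3 / 2 + 2 * x) * ((3 / 2 + 2 * x) + 1)))
        = gauss_lam i"
      unfolding gauss_lam_def Let_def i x_def[symmetric]
      using x by (simp add: x_def[symmetric] divide_simps add_nonneg_eq_0_iff) (simp add: algebra_simps)
    then show ?thesis
      by (subst scaled[of "3 / 2 + 2 * x" "4 / 3 + x" "2 / 3 + x"])
        (simp_all add: i gauss_a_def x_def doubleton_eq_iff)
  qed
qed

lemma gauss_coeff_Suc: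
  "gauss_coeff i (Suc k) = gauss_coeff i k *
    (- 27 / 4 * (gauss_a i + of_nat k) * (1 + of_nat i - gauss_a i + of_nat k)
      / ((1 / 2 + of_nat i + of_nat k) * (of_nat k + 1)))"
proof -
  have "(u * U) * (P * p) * (Q * q) / ((R * r) * (s * S)) = U * P * Q / (R * S) * (u * p * q / (r * s))"
    for u U p P q Q r R s S :: rat
    by (simp add: ac_simps)
  then show ?thesis
    unfolding gauss_coeff_def power_Suc pochhammer_Suc fact_Suc of_nat_Suc add.commute[of 1 "of_nat k"] .
qed

lemma gauss_coeff_first_binomial: "gauss_coeff 0 k = (- 1) ^ k * of_nat ((3 * k) choose k)"
proof -
  have "gauss_coeff 0 k = (- 1) ^ k * (fact (3 * k) / (fact k * fact (2 * k)))"
  proof (induction k)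
    case (Suc k)
    define x where "x = (of_nat k :: rat)"
    have x: "x \<ge> 0" by (simp add: x_def)
    have "gauss_coeff 0 (Suc k) = gauss_coeff 0 k * (- 27 / 4 * (2 / 3 + x) * (1 / 3 + x) / ((1 / 2 + x) * (x + 1)))"
      by (simp add: gauss_coeff_Suc gauss_a_def x_def)
    also have "- 27 / 4 * (2 / 3 + x) * (1 / 3 + x) / ((1 / 2 + x) * (x + 1))
      = - ((3 * x + 3) * (3 * x + 2) * (3 * x + 1) / ((x + 1) * ((2 * x + 2) * (2 * x + 1))))"
      using x by (simp add: divide_simps add_nonneg_eq_0_iff) (simp add: algebra_simps)
    also have "gauss_coeff 0 k * \<dots> = (- 1) ^ Suc k *
        (((3 * x + 3) * (3 * x + 2) * (3 * x + 1) * fact (3 * k))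
          / (((x + 1) * fact k) * ((2 * x + 2) * (2 * x + 1) * fact (2 * k))))"
      unfolding Suc by (simp add: ac_simps)
    also have "(3 * x + 3) * (3 * x + 2) * (3 * x + 1) * fact (3 * k) = fact (3 * Suc k)"
      by (simp add: x_def numeral_3_eq_3 algebra_simps)
    also have "(2 * x + 2) * (2 * x + 1) * fact (2 * k) = fact (2 * Suc k)"
      by (simp add: x_def algebra_simps)
    also have "(x + 1) * fact k = fact (Suc k)"
      by (simp add: x_def algebra_simps)
    finally show ?case .
  qed simp
  then show ?thesis by (simp add: binomial_fact)
qed

lemma gauss_coeff_second_binomial: "gauss_coeff 1 k = (- 1) ^ k * of_nat ((3 * k + 1) choose k)"
proof -
  have "gauss_coeff 1 k = (- 1) ^ k * (fact (3 * k + 1) / (fact k * fact (2 * k + 1)))"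
  proof (induction k)
    case (Suc k)
    define x where "x = (of_nat k :: rat)"
    have x: "x \<ge> 0" by (simp add: x_def)
    have "gauss_coeff 1 (Suc k) = gauss_coeff 1 k * (- 27 / 4 * (2 / 3 + x) * (4 / 3 + x) / ((3 / 2 + x) * (x + 1)))"
      by (simp add: gauss_coeff_Suc gauss_a_def x_def)
    also have "- 27 / 4 * (2 / 3 + x) * (4 / 3 + x) / ((3 / 2 + x) * (x + 1))
      = - ((3 * x + 4) * (3 * x + 3) * (3 * x + 2) / ((x + 1) * ((2 * x + 3) * (2 * x + 2))))"
      using x by (simp add: divide_simps add_nonneg_eq_0_iff) (simp add: algebra_simps)
    also have "gauss_coeff 1 k * \<dots> = (- 1) ^ Suc k *
        (((3 * x + 4) * (3 * x + 3) * (3 * x + 2) * fact (3 * k + 1))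
          / (((x + 1) * fact k) * ((2 * x + 3) * (2 * x + 2) * fact (2 * k + 1))))"
      unfolding Suc by (simp add: ac_simps)
    also have "(3 * x + 4) * (3 * x + 3) * (3 * x + 2) * fact (3 * k + 1) = fact (3 * Suc k + 1)"
      by (simp add: x_def numeral_3_eq_3 algebra_simps)
    also have "(2 * x + 3) * (2 * x + 2) * fact (2 * k + 1) = fact (2 * Suc k + 1)"
      by (simp add: x_def algebra_simps)
    also have "(x + 1) * fact k = fact (Suc k)"
      by (simp add: x_def algebra_simps)
    finally show ?case .
  qed simp
  moreover have "3 * k + 1 - k = 2 * k + 1" by simp
  ultimately show ?thesis by (simp add: binomial_fact del: fact_Suc)
qed

text \<open>
  Column \<open>j\<close> of this row is the coefficient of \<open>t\<close> to the power \<open>N - 1 - j\<close> in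
  \<open>G\<^sub>i\<close> times the \<open>d\<close>-th power of \<open>t\<close>.
\<close>

definition gauss_row :: "nat \<Rightarrow> nat \<Rightarrow> nat \<Rightarrow> nat \<Rightarrow> rat" where
  "gauss_row N d i j = (if d + j < N then gauss_coeff i (N - Suc (d + j)) else 0)"

lemma gauss_row_contiguity:
  "gauss_row N d i j = gauss_row N d (Suc i) j + gauss_lam i * gauss_row N (Suc d) (Suc (Suc i)) j"
proof (cases "d + j < N")
  case True
  show ?thesis
  proof (cases "N - Suc (d + j)")
    case 0
    with True show ?thesis by (simp add: gauss_row_def)
  next
    case (Suc k)
    then have "N - Suc (Suc d + j) = k" "Suc d + j < N" by simp_all
    with True Suc gauss_coeff_contiguity[of i k] show ?thesis
      by (simp add: gauss_row_def)
  qed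
qed (simp add: gauss_row_def)

text \<open>
  Writing \<open>(d, i)\<close> for the row of the \<open>d\<close>-fold shift of \<open>G\<^sub>i\<close>, the relation
  \<open>(d, i) = (d, i + 1) + \<lambda>\<^sub>i (d + 1, i + 2)\<close> is applied until only rows of the form
  \<open>(e, e + 1)\<close> are left. With \<open>s = d + 1 - i\<close>, the number \<open>d + s\<close> stays the same in the second
  summand and drops by one in the first, while \<open>s\<close> drops by one in both; so the row
  \<open>(d + s, d + s + 1)\<close> occurs once, with a product of \<open>\<lambda>\<close>'s as its coefficient.
\<close>

lemma gauss_row_reduction:
  assumes "i + s = Suc d"
  shows "\<exists>c. \<forall>j. gauss_row N d i j
    = (\<Prod>t<s. gauss_lam (i + 2 * t)) * gauss_row N (d + s) (Suc (d + s)) j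
      + (\<Sum>e<d + s. c e * gauss_row N e (Suc e) j)"
  using assms
proof (induction s arbitrary: d i)
  case 0
  then show ?case by (intro exI[of _ "\<lambda>_. 0"]) simp
next
  case (Suc s)
  let ?P = "\<Prod>t<s. gauss_lam (Suc i + 2 * t)" and ?Q = "\<Prod>t<s. gauss_lam (Suc (Suc i) + 2 * t)"
  from Suc.IH[of "Suc i" d] Suc.prems obtain c where
    c: "\<And>j. gauss_row N d (Suc i) j = ?P * gauss_row N (d + s) (Suc (d + s)) j
      + (\<Sum>e<d + s. c e * gauss_row N e (Suc e) j)" by auto
  from Suc.IH[of "Suc (Suc i)" "Suc d"] Suc.prems obtain c' where
    c': "\<And>j. gauss_row N (Suc d) (Suc (Suc i)) j = ?Q * gauss_row N (Suc d + s) (Suc (Suc d + s)) j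
      + (\<Sum>e<Suc d + s. c' e * gauss_row N e (Suc e) j)" by auto
  let ?c = "\<lambda>e. (if e < d + s then c e else ?P) + gauss_lam i * c' e"
  have prod: "(\<Prod>t<Suc s. gauss_lam (i + 2 * t)) = gauss_lam i * ?Q"
    by (simp add: prod.lessThan_Suc_shift del: prod.lessThan_Suc)
  have reduced: "gauss_row N d i j = gauss_lam i * ?Q * gauss_row N (d + Suc s) (Suc (d + Suc s)) j
      + (\<Sum>e<d + Suc s. ?c e * gauss_row N e (Suc e) j)" for j
  proof -
    have "(\<Sum>e<d + Suc s. ?c e * gauss_row N e (Suc e) j)
        = (\<Sum>e<d + s. c e * gauss_row N e (Suc e) j) + ?P * gauss_row N (d + s) (Suc (d + s)) j
          + gauss_lam i * (\<Sum>e<Suc d + s. c' e * gauss_row N e (Suc e) j)"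
      by (simp add: distrib_right sum.distrib sum_distrib_left mult.assoc distrib_left)
    then show ?thesis
      unfolding gauss_row_contiguity[of N d i j] c c' by (simp add: algebra_simps)
  qed
  show ?case
    unfolding prod by (intro exI[of _ ?c] allI) (rule reduced)
qed

text \<open>
  The product \<open>\<lambda>\<^sub>e\<^sub>-\<^sub>1 \<lambda>\<^sub>e\<^sub>-\<^sub>3 \<dots>\<close> down to index \<open>0\<close> or \<open>1\<close>, which the row reduction produces in
  row \<open>e\<close> from the bottom.
\<close>

definition pivot :: "nat \<Rightarrow> rat" where
  "pivot e = (\<Prod>t<Suc e div 2. gauss_lam (1 - e mod 2 + 2 * t))"

text \<open>
  Counting rows by \<open>e\<close> from the bottom, row \<open>e\<close> is a combination of the rows \<open>(e', e' + 1)\<close> with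
  \<open>e' \<le> e\<close>. These rows form a lower unitriangular matrix \<open>F\<close>, because every \<open>G\<^sub>i\<close> has constant term \<open>1\<close>, and the
  coefficients an upper triangular matrix \<open>L\<close> with the pivots on its diagonal.
\<close>

lemma det_gauss_rows:
  "det (mat N N (\<lambda>(a, j). gauss_row N ((N - Suc a) div 2) (1 - (N - Suc a) mod 2) j)) = (\<Prod>e<N. pivot e)"
proof -
  have "\<forall>e. \<exists>c. \<forall>j. gauss_row N (e div 2) (1 - e mod 2) j
      = pivot e * gauss_row N e (Suc e) j + (\<Sum>e'<e. c e' * gauss_row N e' (Suc e') j)"
  proof
    fix e :: nat
    have "1 - e mod 2 + Suc e div 2 = Suc (e div 2)" "e div 2 + Suc e div 2 = e"
      by (cases "even e"; auto elim!: evenE oddE)+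
    with gauss_row_reduction[of "1 - e mod 2" "Suc e div 2" "e div 2" N]
    show "\<exists>c. \<forall>j. gauss_row N (e div 2) (1 - e mod 2) j
      = pivot e * gauss_row N e (Suc e) j + (\<Sum>e'<e. c e' * gauss_row N e' (Suc e') j)"
      unfolding pivot_def by simp
  qed
  then obtain c where c: "\<And>e j. gauss_row N (e div 2) (1 - e mod 2) j
      = pivot e * gauss_row N e (Suc e) j + (\<Sum>e'<e. c e e' * gauss_row N e' (Suc e') j)"
    by metis
  define L where "L = mat N N (\<lambda>(a, a'). if a' = a then pivot (N - Suc a)
      else if a < a' then c (N - Suc a) (N - Suc a') else 0)"
  define F where "F = mat N N (\<lambda>(a, j). gauss_row N (N - Suc a) (N - a) j)"
  have carr: "L \<in> carrier_mat N N" "F \<in> carrier_mat N N" by (simp_all add: L_def F_def)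
  have "mat N N (\<lambda>(a, j). gauss_row N ((N - Suc a) div 2) (1 - (N - Suc a) mod 2) j) = L * F"
  proof (rule eq_matI)
    fix a j
    assume "a < dim_row (L * F)" "j < dim_col (L * F)"
    then have a: "a < N" and j: "j < N" by (simp_all add: L_def F_def)
    define e where "e = N - Suc a"
    have eN: "e < N" "Suc e = N - a" using a by (auto simp: e_def)
    let ?g = "\<lambda>e'. (if e' = e then pivot e else if e' < e then c e e' else 0) * gauss_row N e' (Suc e') j"
    have "(L * F) $$ (a, j) = (\<Sum>a'<N. L $$ (a, a') * F $$ (a', j))"
      using a j by (simp add: L_def F_def scalar_prod_def atLeast0LessThan)
    also have "\<dots> = (\<Sum>a'<N. ?g (N - Suc a'))"
      using a j by (intro sum.cong refl) (auto simp: L_def F_def e_def Suc_diff_Suc)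
    also have "\<dots> = sum ?g {..<N}" by (rule sum.nat_diff_reindex)
    also have "\<dots> = sum ?g {..<Suc e}"
      using eN by (intro sum.mono_neutral_right) auto
    also have "\<dots> = pivot e * gauss_row N e (Suc e) j + (\<Sum>e'<e. c e e' * gauss_row N e' (Suc e') j)"
      by (simp add: sum.lessThan_Suc)
    also have "\<dots> = gauss_row N (e div 2) (1 - e mod 2) j" by (rule c[symmetric])
    finally show "mat N N (\<lambda>(a, j). gauss_row N ((N - Suc a) div 2) (1 - (N - Suc a) mod 2) j) $$ (a, j)
        = (L * F) $$ (a, j)"
      using a j by (simp add: e_def)
  qed (simp_all add: L_def F_def)
  moreover have "det L = (\<Prod>e<N. pivot e)"
  proof -
    have "det L = prod_list (diag_mat L)"
      by (rule det_upper_triangular[OF _ carr(1)]) (auto simp: L_def upper_triangular_def)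
    also have "\<dots> = (\<Prod>a<N. pivot (N - Suc a))"
      by (simp add: prod_list_diag_mat L_def)
    finally show ?thesis by (simp add: prod.nat_diff_reindex)
  qed
  moreover have "det F = 1"
  proof -
    have "det F = prod_list (diag_mat F)"
      by (rule det_lower_triangular[OF _ carr(2)]) (auto simp: F_def gauss_row_def)
    also have "\<dots> = 1"
      by (simp add: prod_list_diag_mat F_def gauss_row_def)
    finally show ?thesis .
  qed
  ultimately show ?thesis using det_mult[OF carr] by simp
qed

text \<open>
  The entry in row \<open>a\<close> is the coefficient of \<open>z\<close> to the power \<open>q = \<lfloor>(N + a)/2\<rfloor>\<close> in
  \<open>(1 + z)\<close> to the power \<open>N - a + b\<close>. The factor \<open>B\<close> replaces the series \<open>(1 + z)\<close> to the power \<open>b\<close>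
  by \<open>z\<close> to the power \<open>b\<close>, and \<open>U\<close> replaces this in turn by the product of \<open>z\<close> to the power \<open>j\<close> and
  \<open>1 + z\<close> to the power \<open>2j - 2N - 1\<close>. The exponent is chosen such that the result
  depends on \<open>q\<close> and \<open>j\<close> only through \<open>k = q - j\<close>: it is the coefficient of \<open>z\<close> to the power \<open>k\<close> in
  \<open>1 + z\<close> to the power \<open>- 2k - 1\<close> or \<open>- 2k - 2\<close>, depending on the parity of \<open>N + a\<close>.
\<close>

lemma det_binomial_to_gauss_rows:
  "det (mat N N (\<lambda>(a, b). of_nat ((N - a + b) choose ((N + a) div 2)) :: rat))
    = det (mat N N (\<lambda>(a, j). gauss_row N ((N - Suc a) div 2) (1 - (N - Suc a) mod 2) j))"
proof -
  define q where "q a = (N + a) div 2" for a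
  define A where "A = mat N N (\<lambda>(a, l). if l \<le> q a then of_nat ((N - a) choose (q a - l)) else (0::rat))"
  define B where "B = mat N N (\<lambda>(l, b). of_nat (b choose l) :: rat)"
  define U where "U = mat N N (\<lambda>(l, j). if j \<le> l then (2 * of_nat j - 2 * of_nat N - 1 gchoose (l - j)) else (0::rat))"
  have carr: "A \<in> carrier_mat N N" "B \<in> carrier_mat N N" "U \<in> carrier_mat N N"
    by (simp_all add: A_def B_def U_def)
  have q: "q a < N" if "a < N" for a using that by (simp add: q_def)
  have "det B = prod_list (diag_mat B)"
    by (rule det_upper_triangular[OF _ carr(2)]) (auto simp: B_def upper_triangular_def)
  then have detB: "det B = 1" by (simp add: prod_list_diag_mat B_def)
  have "det U = prod_list (diag_mat U)"
    by (rule det_lower_triangular[OF _ carr(3)]) (auto simp: U_def)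
  then have detU: "det U = 1" by (simp add: prod_list_diag_mat U_def)
  have AB: "mat N N (\<lambda>(a, b). of_nat ((N - a + b) choose ((N + a) div 2)) :: rat) = A * B"
  proof (rule eq_matI)
    fix a b
    assume "a < dim_row (A * B)" "b < dim_col (A * B)"
    then have ab: "a < N" "b < N" by (simp_all add: A_def B_def)
    have "(A * B) $$ (a, b) = (\<Sum>l<N. A $$ (a, l) * B $$ (l, b))"
      using ab by (simp add: A_def B_def scalar_prod_def atLeast0LessThan)
    also have "\<dots> = (\<Sum>l\<le>q a. A $$ (a, l) * B $$ (l, b))"
      using ab q[of a] by (intro sum.mono_neutral_right) (auto simp: A_def B_def)
    also have "\<dots> = of_nat (\<Sum>l\<le>q a. (b choose l) * ((N - a) choose (q a - l)))"
      unfolding of_nat_sum using ab q[of a]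
      by (intro sum.cong refl) (auto simp: A_def B_def)
    also have "(\<Sum>l\<le>q a. (b choose l) * ((N - a) choose (q a - l))) = (b + (N - a)) choose q a"
      by (rule vandermonde)
    finally show "mat N N (\<lambda>(a, b). of_nat ((N - a + b) choose ((N + a) div 2)) :: rat) $$ (a, b)
        = (A * B) $$ (a, b)"
      using ab by (simp add: q_def add.commute)
  qed (simp_all add: A_def B_def)
  have AU: "mat N N (\<lambda>(a, j). gauss_row N ((N - Suc a) div 2) (1 - (N - Suc a) mod 2) j) = A * U"
  proof (rule eq_matI)
    fix a j
    assume "a < dim_row (A * U)" "j < dim_col (A * U)"
    then have aj: "a < N" "j < N" by (simp_all add: A_def U_def)
    define e where "e = N - Suc a"
    have e: "N = Suc (a + e)" using aj by (simp add: e_def)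
    have qe: "q a + e div 2 + 1 = N" unfolding q_def e by (cases "even e"; auto elim!: evenE oddE)
    let ?x = "2 * of_nat j - 2 * of_nat N - 1 :: rat"
    have sum: "(A * U) $$ (a, j) = (\<Sum>l<N. A $$ (a, l) * U $$ (l, j))"
      using aj by (simp add: A_def U_def scalar_prod_def atLeast0LessThan)
    have "gauss_row N (e div 2) (1 - e mod 2) j = (A * U) $$ (a, j)"
    proof (cases "j \<le> q a")
      case False
      then have "A $$ (a, l) * U $$ (l, j) = 0" if "l < N" for l
        using that aj by (auto simp: A_def U_def)
      with sum have "(A * U) $$ (a, j) = 0" by simp
      with False qe show ?thesis by (simp add: gauss_row_def)
    next
      case True
      define k where "k = q a - j"
      have k: "q a = j + k" using True by (simp add: k_def)
      note sum
      also have "(\<Sum>l<N. A $$ (a, l) * U $$ (l, j)) = (\<Sum>l\<in>{j..q a}. A $$ (a, l) * U $$ (l, j))"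
        using aj q[of a] by (intro sum.mono_neutral_right) (auto simp: A_def U_def)
      also have "\<dots> = (\<Sum>l\<in>{j..q a}. (?x gchoose (l - j)) * (of_nat (N - a) gchoose (q a - l)))"
        using aj q[of a] by (intro sum.cong refl) (auto simp: A_def U_def binomial_gbinomial)
      also have "\<dots> = (\<Sum>l\<le>k. (?x gchoose l) * (of_nat (N - a) gchoose (k - l)))"
        by (rule sum.reindex_bij_witness[of _ "\<lambda>l. l + j" "\<lambda>l. l - j"]) (auto simp: k add.commute)
      also have "\<dots> = (?x + of_nat (N - a)) gchoose k"
        using gbinomial_Vandermonde[of ?x "of_nat (N - a)" k] by (simp only: atMost_atLeast0)
      also have "\<dots> = (- 1) ^ k * (of_nat k - (?x + of_nat (N - a)) - 1 gchoose k)"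
        by (rule gbinomial_negated_upper)
      also have "of_nat k - (?x + of_nat (N - a)) - 1 = of_nat (3 * k + (1 - e mod 2))"
      proof (cases "even e")
        case True
        then obtain h where h: "e = 2 * h" by (auto elim: evenE)
        with qe e k have "a + h = j + k" by simp
        then have "of_nat a + of_nat h = (of_nat j + of_nat k :: rat)" by (metis of_nat_add)
        then show ?thesis unfolding e h by simp
      next
        case False
        then obtain h where h: "e = 2 * h + 1" by (auto elim: oddE)
        with qe e k have "a + h + 1 = j + k" by simp
        then have "of_nat a + of_nat h + 1 = (of_nat j + of_nat k :: rat)"
          by (metis of_nat_add of_nat_1)
        then show ?thesis unfolding e h by simp
      qed
      also have "(- 1) ^ k * (of_nat (3 * k + (1 - e mod 2)) gchoose k) = gauss_coeff (1 - e mod 2) k"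
        using gauss_coeff_first_binomial[of k] gauss_coeff_second_binomial[of k]
        by (cases "even e") (simp_all add: binomial_gbinomial odd_iff_mod_2_eq_one)
      finally have "(A * U) $$ (a, j) = gauss_coeff (1 - e mod 2) k" .
      moreover have "N - Suc (e div 2 + j) = k" "e div 2 + j < N" using qe k by simp_all
      ultimately show ?thesis by (simp add: gauss_row_def)
    qed
    then show "mat N N (\<lambda>(a, j). gauss_row N ((N - Suc a) div 2) (1 - (N - Suc a) mod 2) j) $$ (a, j)
        = (A * U) $$ (a, j)"
      using aj by (simp add: e_def)
  qed (simp_all add: A_def U_def)
  show ?thesis
    unfolding AB AU det_mult[OF carr(1,2)] det_mult[OF carr(1,3)] detB detU ..
qed

lemma gauss_lam_even: "gauss_lam (2 * m) = 3 / 2 * (3 * of_nat m + 2) * (6 * of_nat m + 1)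
    / ((4 * of_nat m + 1) * (4 * of_nat m + 3))"
  by (simp add: gauss_lam_def Let_def)

lemma gauss_lam_odd: "gauss_lam (Suc (2 * m)) = 3 / 2 * (3 * of_nat m + 4) * (6 * of_nat m + 5)
    / ((4 * of_nat m + 3) * (4 * of_nat m + 5))"
  by (simp add: gauss_lam_def Let_def)

lemma pivot_even: "pivot (2 * k) = (\<Prod>t<k. gauss_lam (Suc (2 * t)))"
  by (simp add: pivot_def)

lemma pivot_odd: "pivot (Suc (2 * k)) = (\<Prod>t<Suc k. gauss_lam (2 * t))"
proof -
  have "Suc (2 * k) mod 2 = 1" "Suc (Suc (2 * k)) div 2 = Suc k" by simp_all
  then show ?thesis by (simp only: pivot_def) simp
qed

text \<open>
  The factor by which the determinant grows when its size \<open>2k - 1\<close> is raised to \<open>2k + 1\<close>; the next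
  lemma has the factor from \<open>2k\<close> to \<open>2k + 2\<close>.
\<close>

lemma prod_gauss_lam:
  "(\<Prod>t<k. gauss_lam (2 * t)) * (\<Prod>t<k. gauss_lam (Suc (2 * t)))
    = (3 * of_nat k + 1) * fact (6 * k) * fact (2 * k) / (fact (4 * k + 1) * fact (4 * k))"
proof (induction k)
  case 0
  show ?case by simp
next
  case (Suc k)
  define x where "x = (of_nat k :: rat)"
  have x: "x \<ge> 0" by (simp add: x_def)
  have f6: "fact (6 * Suc k) = (6*x+6)*(6*x+5)*(6*x+4)*(6*x+3)*(6*x+2)*(6*x+1) * (fact (6 * k) :: rat)"
    by (simp add: x_def numeral_eq_Suc) (simp add: algebra_simps)
  have f2: "fact (2 * Suc k) = (2*x+2)*(2*x+1) * (fact (2 * k) :: rat)"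
    by (simp add: x_def numeral_eq_Suc) (simp add: algebra_simps)
  have f4: "fact (4 * Suc k) = (4*x+4)*(4*x+3)*(4*x+2)*(4*x+1) * (fact (4 * k) :: rat)"
    by (simp add: x_def numeral_eq_Suc) (simp add: algebra_simps)
  have f41: "fact (4 * Suc k + 1) = (4*x+5)*(4*x+4)*(4*x+3)*(4*x+2) * (fact (4 * k + 1) :: rat)"
    by (simp add: x_def numeral_eq_Suc) (simp add: algebra_simps)
  have "(\<Prod>t<Suc k. gauss_lam (2 * t)) * (\<Prod>t<Suc k. gauss_lam (Suc (2 * t)))
      = ((\<Prod>t<k. gauss_lam (2 * t)) * (\<Prod>t<k. gauss_lam (Suc (2 * t)))) * (gauss_lam (2 * k) * gauss_lam (Suc (2 * k)))"
    by simp
  also have "\<dots> = (3 * x + 1) * fact (6 * k) * fact (2 * k) / (fact (4 * k + 1) * fact (4 * k))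
     * (3 / 2 * (3 * x + 2) * (6 * x + 1) / ((4 * x + 1) * (4 * x + 3)) 
      * (3 / 2 * (3 * x + 4) * (6 * x + 5) / ((4 * x + 3) * (4 * x + 5))))"
    by (simp only: Suc gauss_lam_even[of k] gauss_lam_odd[of k] x_def)
  also have "\<dots> = (3 * (x + 1) + 1) * fact (6 * Suc k) * fact (2 * Suc k) / (fact (4 * Suc k + 1) * fact (4 * Suc k))"
  proof -
    have alg: "(3*x+1) * F6 * F2 / (F41 * F4) * (3 / 2 * (3 * x + 2) * (6 * x + 1) / ((4 * x + 1) * (4 * x + 3)) 
      * (3 / 2 * (3 * x + 4) * (6 * x + 5) / ((4 * x + 3) * (4 * x + 5))))
      = (3*(x+1)+1) * ((6*x+6)*(6*x+5)*(6*x+4)*(6*x+3)*(6*x+2)*(6*x+1) * F6) * ((2*x+2)*(2*x+1) * F2)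
        / (((4*x+5)*(4*x+4)*(4*x+3)*(4*x+2) * F41) * ((4*x+4)*(4*x+3)*(4*x+2)*(4*x+1) * F4))"
      if "F41 > 0" "F4 > 0" for F6 F2 F41 F4 :: rat
    proof -
      \<comment> \<open>Dividing out the contents makes the common linear factors of both sides visible.\<close>
      have fac: "6*x+6 = 6*(x+1)" "6*x+4 = 2*(3*x+2)" "6*x+3 = 3*(2*x+1)" "6*x+2 = 2*(3*x+1)"
        "2*x+2 = 2*(x+1)" "4*x+4=4*(x+1)" "4*x+2 = 2*(2*x+1)" "3*(x+1)+1 = 3*x+4" by simp_all
      have "x+1 > 0" "2*x+1>0" "4*x+1>0" "4*x+3>0" "4*x+5>0" using x by simp_all
      then show ?thesis
        unfolding fac using that by (simp add: divide_simps) (simp add: algebra_simps)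
    qed
    show ?thesis unfolding f6 f2 f4 f41 by (rule alg) simp_all
  qed
  finally show ?case by (simp add: x_def)
qed

lemma prod_gauss_lam_shifted:
  "(\<Prod>t<k. gauss_lam (Suc (2 * t))) * (\<Prod>t<Suc k. gauss_lam (2 * t))
    = (3 * of_nat k + 2) * fact (6 * k + 3) * fact (2 * k + 1) / (fact (4 * k + 2) * fact (4 * k + 3))"
proof -
  define x where "x = (of_nat k :: rat)"
  have x: "x \<ge> 0" by (simp add: x_def)
  have f6: "fact (6 * k + 3) = (6*x+3)*(6*x+2)*(6*x+1) * (fact (6 * k) :: rat)"
    by (simp add: x_def numeral_eq_Suc) (simp add: algebra_simps)
  have f2: "fact (2 * k + 1) = (2*x+1) * (fact (2 * k) :: rat)"
    by (simp add: x_def)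
  have f4: "fact (4 * k + 2) = (4*x+2)*(4*x+1) * (fact (4 * k) :: rat)"
    by (simp add: x_def numeral_eq_Suc) (simp add: algebra_simps)
  have f41: "fact (4 * k + 3) = (4*x+3)*(4*x+2) * (fact (4 * k + 1) :: rat)"
    by (simp add: x_def numeral_eq_Suc) (simp add: algebra_simps)
  have "(\<Prod>t<k. gauss_lam (Suc (2 * t))) * (\<Prod>t<Suc k. gauss_lam (2 * t))
     = ((\<Prod>t<k. gauss_lam (2 * t)) * (\<Prod>t<k. gauss_lam (Suc (2 * t)))) * gauss_lam (2 * k)"
    by simp
  also have "\<dots> = (3 * x + 1) * fact (6 * k) * fact (2 * k) / (fact (4 * k + 1) * fact (4 * k))
     * (3 / 2 * (3 * x + 2) * (6 * x + 1) / ((4 * x + 1) * (4 * x + 3)))"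
    by (simp only: prod_gauss_lam[of k] gauss_lam_even[of k] x_def)
  also have "\<dots> = (3 * x + 2) * fact (6 * k + 3) * fact (2 * k + 1) / (fact (4 * k + 2) * fact (4 * k + 3))"
  proof -
    have alg: "(3*x+1) * F6 * F2 / (F41 * F4) * (3 / 2 * (3 * x + 2) * (6 * x + 1) / ((4 * x + 1) * (4 * x + 3)))
      = (3*x+2) * ((6*x+3)*(6*x+2)*(6*x+1) * F6) * ((2*x+1) * F2)
        / (((4*x+2)*(4*x+1) * F4) * ((4*x+3)*(4*x+2) * F41))"
      if "F41 > 0" "F4 > 0" for F6 F2 F41 F4 :: rat
    proof -
      \<comment> \<open>Dividing out the contents makes the common linear factors of both sides visible.\<close>
      have fac: "6*x+3 = 3*(2*x+1)" "6*x+2 = 2*(3*x+1)" "4*x+2 = 2*(2*x+1)" by simp_all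
      have "2*x+1>0" "4*x+1>0" "4*x+3>0" using x by simp_all
      then show ?thesis
        unfolding fac using that by (simp add: divide_simps) (simp add: algebra_simps)
    qed
    show ?thesis unfolding f6 f2 f4 f41 by (rule alg) simp_all
  qed
  finally show ?thesis by (simp add: x_def)
qed

lemma prod_pivot_odd: "(\<Prod>e<Suc (2 * k). pivot e) = CSTCPP (Suc k)"
proof (induction k)
  case 0
  show ?case by (simp add: CSTCPP_def pivot_def)
next
  case (Suc k)
  have "(\<Prod>e<Suc (2 * Suc k). pivot e)
      = (\<Prod>e<Suc (2 * k). pivot e) * (pivot (Suc (2 * k)) * pivot (2 * Suc k))"
    by simp
  also have "\<dots> = CSTCPP (Suc k) * ((3 * of_nat (Suc k) + 1) * fact (6 * Suc k) * fact (2 * Suc k)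
      / (fact (4 * Suc k + 1) * fact (4 * Suc k)))"
    unfolding Suc pivot_odd pivot_even prod_gauss_lam ..
  also have "\<dots> = CSTCPP (Suc (Suc k))"
    unfolding CSTCPP_def by (subst (2) prod.atLeastLessThan_Suc) (simp_all only: le_numeral_extra One_nat_def Suc_le_mono le0)
  finally show ?case .
qed

lemma prod_pivot_even: "(\<Prod>e<2 * Suc k. pivot e) = VSASM (Suc k)"
proof (induction k)
  case 0
  show ?case by (simp add: VSASM_def pivot_def numeral_2_eq_2 gauss_lam_def)
next
  case (Suc k)
  have "(\<Prod>e<2 * Suc (Suc k). pivot e)
      = (\<Prod>e<2 * Suc k. pivot e) * (pivot (2 * Suc k) * pivot (Suc (2 * Suc k)))"
    by simp
  also have "\<dots> = VSASM (Suc k) * ((3 * of_nat (Suc k) + 2) * fact (6 * Suc k + 3) * fact (2 * Suc k + 1)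
      / (fact (4 * Suc k + 2) * fact (4 * Suc k + 3)))"
    unfolding Suc pivot_odd pivot_even prod_gauss_lam_shifted ..
  also have "\<dots> = VSASM (Suc (Suc k))"
    unfolding VSASM_def by (subst (2) prod.atLeastLessThan_Suc) (simp_all only: le_numeral_extra One_nat_def Suc_le_mono le0)
  finally show ?case .
qed

section \<open>The two enumerations\<close>

lemma eval1_schubert_zigzag_pivots:
  "of_int (eval1 (schubert (Suc N) (one_line (zigzag (Suc N))))) = (\<Prod>e<N. pivot e)"
proof -
  have "of_int (eval1 (schubert (Suc N) (one_line (zigzag (Suc N)))))
      = det (map_mat (of_int :: int \<Rightarrow> rat) (mat N N (\<lambda>(a, b). of_nat ((N - a + b) choose ((N + a) div 2)))))"
    unfolding eval1_schubert_zigzag by (rule of_int_hom.hom_det[symmetric])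
  also have "map_mat (of_int :: int \<Rightarrow> rat) (mat N N (\<lambda>(a, b). of_nat ((N - a + b) choose ((N + a) div 2))))
      = mat N N (\<lambda>(a, b). of_nat ((N - a + b) choose ((N + a) div 2)))"
    by (intro eq_matI) auto
  finally show ?thesis
    unfolding det_binomial_to_gauss_rows det_gauss_rows .
qed

lemma w_minus_zigzag: "w_minus k = one_line (zigzag (2 * k))"
  by (simp add: w_minus_def zigzag_def evens_def odds_desc_def)

lemma w_plus_zigzag: "w_plus k = one_line (zigzag (2 * k + 1))"
proof -
  have "(2 * k + 1) div 2 = k" "Suc (2 * k + 1) div 2 = Suc k" by simp_all
  then show ?thesis by (simp only: w_plus_def zigzag_def evens_def odds_desc_def)
qed

theorem proposition5p7:
  fixes k :: nat
  assumes "k \<ge> 1"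
  shows "of_int (eval_mpoly (\<lambda>_. 1) (schubert (2 * k) (w_minus k))) = CSTCPP k
    \<and> of_int (eval_mpoly (\<lambda>_. 1) (schubert (2 * k + 1) (w_plus k))) = VSASM k"
proof -
  from assms obtain l where k: "k = Suc l" by (cases k) auto
  have minus: "2 * k = Suc (Suc (2 * l))" and plus: "2 * k + 1 = Suc (2 * Suc l)"
    by (simp_all add: k)
  have "of_int (eval1 (schubert (2 * k) (w_minus k))) = CSTCPP k"
    unfolding w_minus_zigzag minus eval1_schubert_zigzag_pivots prod_pivot_odd by (simp only: k)
  moreover have "of_int (eval1 (schubert (2 * k + 1) (w_plus k))) = VSASM k"
    unfolding w_plus_zigzag plus eval1_schubert_zigzag_pivots prod_pivot_even by (simp only: k)
  ultimately show ?thesis unfolding eval_mpoly_1 ..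
qed

end
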